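(* Let $G$ be a finite simple graph with $n \ge 1$ vertices. For each vertex $v \in V(G)$ let $c(v)$ denote the largest integer $k$ such that $v$ lies in a subgraph of $G$ isomorphic to the complete graph $K_k$ (so an isolated vertex has $c(v)=1$). Then \[ |E(G)| \le \left\lfloor \frac{n}{2}\sum_{v\in V(G)} \frac{c(v)-1}{c(v)} \right\rfloor . \] Moreover, equality holds if and only if $G \in \mathcal{S} \cup \{X, Y\}$, where $\mathcal{S}$, $X$, $Y$ are as defined in the context.
   Context: For positive integers $n$ and $r$, the Turán graph $T(n,r)$ is the complete multipartite graph on $n$ vertices with $r$ classes, each of size $\lceil n/r\rceil$ or $\lfloor n/r\rfloor$. $\mathcal{S}$ denotes the class of graphs isomorphic to some Turán graph $T(n,r)$ such that, writing $s$ for the remainder of $n$ modulo $r$ (so $n \equiv s \pmod r$, $0 \le s < r$), either $s \le 2$ or $r < \frac{s^2}{s-2}$. $P_k$ denotes the path on $k$ vertices and $\overline{H}$ the complement of a graph $H$. $X$ is the graph $\overline{P_2 \cup P_3}$ on 5 vertices (the "paraglider": a triangle $abc$ plus vertices $d$ and $e$, where $d$ is adjacent to $a,b,c$... equivalently the complement of the disjoint union of an edge and a 3-vertex path), and $Y$ is the graph $\overline{P_3}$ (an edge together with an isolated vertex). *)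

theory Defs
  imports Complex_Main
begin

datatype 'a sgraph = SGraph (verts: "'a set") (edges: "'a set set")

definition pairs_of :: "'a set \<Rightarrow> 'a set set" where
  "pairs_of V = {e. e \<subseteq> V \<and> card e = 2}"

definition finite_simple_graph :: "'a sgraph \<Rightarrow> bool" where
  "finite_simple_graph G \<longleftrightarrow> finite (verts G) \<and> edges G \<subseteq> pairs_of (verts G)"

definition subgraph :: "'a sgraph \<Rightarrow> 'a sgraph \<Rightarrow> bool" where
  "subgraph H G \<longleftrightarrow>
     verts H \<subseteq> verts G \<and> edges H \<subseteq> edges G \<and> edges H \<subseteq> pairs_of (verts H)"

definition graph_iso :: "'a sgraph \<Rightarrow> 'b sgraph \<Rightarrow> bool" (infix "\<simeq>\<^sub>G" 50) where
  "G \<simeq>\<^sub>G H \<longleftrightarrow>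
     (\<exists>f. bij_betw f (verts G) (verts H) \<and>
          (\<forall>u\<in>verts G. \<forall>v\<in>verts G. {u, v} \<in> edges G \<longleftrightarrow> {f u, f v} \<in> edges H))"

definition complement_graph :: "'a sgraph \<Rightarrow> 'a sgraph" where
  "complement_graph G = SGraph (verts G) (pairs_of (verts G) - edges G)"

definition disjoint_union :: "'a sgraph \<Rightarrow> 'b sgraph \<Rightarrow> ('a + 'b) sgraph" where
  "disjoint_union G H =
     SGraph (verts G <+> verts H) ((`) Inl ` edges G \<union> (`) Inr ` edges H)"

definition complete_graph :: "nat \<Rightarrow> nat sgraph" where
  "complete_graph k = SGraph {..<k} (pairs_of {..<k})"

definition path_graph :: "nat \<Rightarrow> nat sgraph" where
  "path_graph k = SGraph {..<k} {{i, Suc i} | i. Suc i < k}"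

definition clique_number_at :: "'a sgraph \<Rightarrow> 'a \<Rightarrow> nat" where
  "clique_number_at G v =
     (GREATEST k. \<exists>H. subgraph H G \<and> v \<in> verts H \<and> H \<simeq>\<^sub>G complete_graph k)"

text \<open>The function \<open>p\<close> sends a vertex to the index of its class. Classes may be empty, which
  the size condition permits only for \<open>r > n\<close>; the graph is then complete.\<close>

definition is_turan_graph :: "nat \<Rightarrow> nat \<Rightarrow> 'a sgraph \<Rightarrow> bool" where
  "is_turan_graph n r G \<longleftrightarrow>
     finite (verts G) \<and> card (verts G) = n \<and>
     (\<exists>p. p ` verts G \<subseteq> {..<r} \<and>
          (\<forall>i<r. int (card {v \<in> verts G. p v = i})
                   \<in> {\<lceil>real n / real r\<rceil>, \<lfloor>real n / real r\<rfloor>}) \<and>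
          edges G = {{u, v} | u v. u \<in> verts G \<and> v \<in> verts G \<and> p u \<noteq> p v})"

definition in_class_S :: "'a sgraph \<Rightarrow> bool" where
  "in_class_S G \<longleftrightarrow>
     (\<exists>n r s. \<exists>T :: nat sgraph. n > 0 \<and> r > 0 \<and> is_turan_graph n r T \<and> G \<simeq>\<^sub>G T \<and>
        s = n mod r \<and> (s \<le> 2 \<or> real r < (real s)\<^sup>2 / (real s - 2)))"

definition graph_X :: "(nat + nat) sgraph" where
  "graph_X = complement_graph (disjoint_union (path_graph 2) (path_graph 3))"

definition graph_Y :: "nat sgraph" where
  "graph_Y = complement_graph (path_graph 3)"

end

theory Submission
  imports Defs
begin

text \<open>Let \<open>D\<close> be the number of ordered pairs of non-adjacent (possibly equal) vertices minus
  \<open>n\<close> times the sum of \<open>1/c(v)\<close>. Twice the gap between the real bound and the number of edges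
  is \<open>D\<close>, so the theorem says \<open>D \<ge> 0\<close> and characterises \<open>D < 2\<close>. If \<open>K\<close> is a maximum clique, of
  size \<open>k\<close>, then each vertex \<open>v\<close> outside \<open>K\<close> has at least \<open>k - c(v) + 1\<close> non-neighbours in
  \<open>K\<close>. Removing \<open>K\<close> therefore lowers \<open>D\<close> by the sum over these \<open>v\<close> of
  \<open>(k - c(v)) (2 - 1/c(v))\<close> plus twice the excess of non-neighbours, and \<open>D \<ge> 0\<close> follows by
  induction.

  If \<open>D < 2\<close>, the excess vanishes for every maximum clique and at most one vertex \<open>z\<close> has
  \<open>c(z) < k\<close>, in which case \<open>c(z) = k - 1\<close>. By exchanging single vertices of maximum cliques, the
  vertices with \<open>c(v) = k\<close> induce a complete \<open>k\<close>-partite graph. Without \<open>z\<close>, the variance of the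
  class sizes forces a balanced partition; with \<open>z\<close>, which is non-adjacent to exactly two
  classes, an integer inequality leaves only \<open>X\<close> and \<open>Y\<close>.\<close>

section \<open>The deficit of a clique bound\<close>

lemma remainder_term_ge:
  fixes c k :: nat
  assumes "1 \<le> c" "c \<le> k"
  shows "(real k - real c) * (2 - 1 / real c) \<ge> real k - real c"
proof -
  have "2 - 1 / real c \<ge> 1" using assms by simp
  then show ?thesis using assms mult_left_mono[of 1 "2 - 1 / real c" "real k - real c"] by simp
qed

locale symmetric_adjacency =
  fixes adj :: "'a \<Rightarrow> 'a \<Rightarrow> bool"
  assumes adj_sym: "adj u v \<Longrightarrow> adj v u"
    and adj_irrefl: "\<not> adj v v"
begin

definition clique :: "'a set \<Rightarrow> bool" where
  "clique K \<longleftrightarrow> (\<forall>u\<in>K. \<forall>v\<in>K. u \<noteq> v \<longrightarrow> adj u v)"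

definition nonadj :: "'a \<Rightarrow> 'a \<Rightarrow> real" where
  "nonadj u v = (if adj u v then 0 else 1)"

text \<open>A majorant of the clique numbers instead of their exact values: it passes to vertex
  subsets and survives truncation, as the induction in \<open>deficit_nonneg\<close>
  requires.\<close>

definition clique_bound :: "'a set \<Rightarrow> ('a \<Rightarrow> nat) \<Rightarrow> bool" where
  "clique_bound V c \<longleftrightarrow> (\<forall>K v. K \<subseteq> V \<longrightarrow> clique K \<longrightarrow> v \<in> K \<longrightarrow> card K \<le> c v)"

definition deficit :: "'a set \<Rightarrow> ('a \<Rightarrow> nat) \<Rightarrow> real" where
  "deficit V c = (\<Sum>u\<in>V. \<Sum>v\<in>V. nonadj u v) - real (card V) * (\<Sum>v\<in>V. 1 / real (c v))"

lemma nonadj_sym: "nonadj u v = nonadj v u"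
  using adj_sym by (auto simp: nonadj_def)

lemma nonadj_self [simp]: "nonadj v v = 1"
  using adj_irrefl by (simp add: nonadj_def)

lemma sum_nonadj: "finite A \<Longrightarrow> (\<Sum>x\<in>A. nonadj x v) = real (card {x\<in>A. \<not> adj x v})"
  by (simp add: nonadj_def sum.If_cases Int_def)

lemma clique_subset: "clique K \<Longrightarrow> L \<subseteq> K \<Longrightarrow> clique L"
  by (auto simp: clique_def)

lemma clique_insert:
  assumes "clique K" and "\<And>x. x \<in> K \<Longrightarrow> adj x v"
  shows "clique (insert v K)"
  using assms adj_sym by (auto simp: clique_def)

lemma clique_bound_subset: "clique_bound V c \<Longrightarrow> W \<subseteq> V \<Longrightarrow> clique_bound W c"
  unfolding clique_bound_def by blast

lemma clique_bound_pos:
  assumes "clique_bound V c" and "v \<in> V"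
  shows "c v \<ge> 1"
  using assms(1)[unfolded clique_bound_def, rule_format, of "{v}" v] assms(2)
  by (simp add: clique_def)

lemma deficit_mono:
  assumes "\<And>v. v \<in> V \<Longrightarrow> 1 \<le> c v \<and> c v \<le> c' v"
  shows "deficit V c \<le> deficit V c'"
proof -
  have "(\<Sum>v\<in>V. 1 / real (c' v)) \<le> (\<Sum>v\<in>V. 1 / real (c v))"
    using assms by (intro sum_mono frac_le) (auto simp: Suc_le_eq)
  then show ?thesis
    unfolding deficit_def by (simp add: mult_left_mono)
qed

text \<open>Inside \<open>K\<close> only the diagonal counts as non-adjacent, and the reciprocals
  over \<open>K\<close> sum to 1 because \<open>c\<close> equals \<open>card K\<close> there. The
  cross terms between \<open>K\<close> and the rest occur twice; they are arranged so that both
  remaining sums have nonnegative terms when \<open>c\<close> is a clique bound with values at most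
  \<open>card K\<close>.\<close>

lemma deficit_remove_clique:
  assumes "finite V" and "K \<subseteq> V" and "clique K" and "K \<noteq> {}"
    and cK: "\<And>v. v \<in> K \<Longrightarrow> c v = card K"
    and c1: "\<And>v. v \<in> V \<Longrightarrow> c v \<ge> 1"
  shows "deficit V c = deficit (V - K) c
     + (\<Sum>v\<in>V - K. (real (card K) - real (c v)) * (2 - 1 / real (c v)))
     + 2 * (\<Sum>v\<in>V - K. (\<Sum>x\<in>K. nonadj x v) - (real (card K) - real (c v) + 1))"
proof -
  define R where "R = V - K"
  define k where "k = real (card K)"
  have fin: "finite K" "finite R"
    using assms finite_subset[of K V] by (auto simp: R_def)
  have V: "V = K \<union> R" and disj: "K \<inter> R = {}"
    using assms by (auto simp: R_def)
  have kpos: "k > 0"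
    using fin assms(4) by (simp add: k_def card_gt_0_iff)
  have split: "(\<Sum>v\<in>V. g v) = (\<Sum>v\<in>K. g v) + (\<Sum>v\<in>R. g v)" for g :: "'a \<Rightarrow> real"
    unfolding V using fin disj by (simp add: sum.union_disjoint)
  have row: "(\<Sum>v\<in>K. nonadj u v) = 1" if "u \<in> K" for u
  proof -
    have "(\<Sum>v\<in>K. nonadj u v) = (\<Sum>v\<in>K. if v = u then 1 else 0)"
      using assms(3) that adj_irrefl by (intro sum.cong) (auto simp: nonadj_def clique_def)
    then show ?thesis using fin that by simp
  qed
  have KK: "(\<Sum>u\<in>K. \<Sum>v\<in>K. nonadj u v) = k"
    by (simp add: row k_def)
  have KR: "(\<Sum>u\<in>K. \<Sum>v\<in>R. nonadj u v) = (\<Sum>v\<in>R. \<Sum>x\<in>K. nonadj x v)"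
    by (rule sum.swap)
  have RK: "(\<Sum>u\<in>R. \<Sum>v\<in>K. nonadj u v) = (\<Sum>v\<in>R. \<Sum>x\<in>K. nonadj x v)"
    by (intro sum.cong refl) (rule nonadj_sym)
  have inv_K: "(\<Sum>v\<in>K. 1 / real (c v)) = 1"
    using kpos cK by (simp add: k_def)
  have cardV: "real (card V) = k + real (card R)"
    unfolding V k_def using fin disj by (simp add: card_Un_disjoint)
  \<comment> \<open>The left side is the part of the outer sums that does not involve
    \<open>nonadj\<close>; the right side is what \<open>v\<close> contributes to the product of
    \<open>card V\<close> with the reciprocal sum, apart from the product over the rest.\<close>
  have summand: "(k - real (c v)) * (2 - 1 / real (c v)) - 2 * (k - real (c v) + 1)
      = - 1 - k * (1 / real (c v))" if "v \<in> R" for v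
    using c1[of v] that by (simp add: R_def field_simps)
  have "(\<Sum>v\<in>R. (k - real (c v)) * (2 - 1 / real (c v))) - 2 * (\<Sum>v\<in>R. k - real (c v) + 1)
      = (\<Sum>v\<in>R. - 1 - k * (1 / real (c v)))"
    unfolding sum_distrib_left sum_subtractf[symmetric] using summand by (intro sum.cong) auto
  also have "\<dots> = - real (card R) - k * (\<Sum>v\<in>R. 1 / real (c v))"
    by (simp add: sum_subtractf sum_distrib_left)
  finally have terms: "(\<Sum>v\<in>R. (k - real (c v)) * (2 - 1 / real (c v)))
      - 2 * (\<Sum>v\<in>R. k - real (c v) + 1) = - real (card R) - k * (\<Sum>v\<in>R. 1 / real (c v))" .
  have "(\<Sum>u\<in>V. \<Sum>v\<in>V. nonadj u v) = k + 2 * (\<Sum>v\<in>R. \<Sum>x\<in>K. nonadj x v)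
      + (\<Sum>u\<in>R. \<Sum>v\<in>R. nonadj u v)"
    by (simp add: split sum.distrib KK KR RK)
  then have "deficit V c = k + 2 * (\<Sum>v\<in>R. \<Sum>x\<in>K. nonadj x v)
      + (\<Sum>u\<in>R. \<Sum>v\<in>R. nonadj u v) - (k + real (card R)) * (1 + (\<Sum>v\<in>R. 1 / real (c v)))"
    unfolding deficit_def cardV split[of "\<lambda>v. 1 / real (c v)"] inv_K by simp
  also have "\<dots> = deficit R c + 2 * (\<Sum>v\<in>R. \<Sum>x\<in>K. nonadj x v)
      + (- real (card R) - k * (\<Sum>v\<in>R. 1 / real (c v)))"
    unfolding deficit_def by (simp add: algebra_simps)
  finally have "deficit V c = deficit R c + 2 * (\<Sum>v\<in>R. \<Sum>x\<in>K. nonadj x v)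
      + (- real (card R) - k * (\<Sum>v\<in>R. 1 / real (c v)))" .
  moreover have "(\<Sum>v\<in>R. (\<Sum>x\<in>K. nonadj x v) - (k - real (c v) + 1))
      = (\<Sum>v\<in>R. \<Sum>x\<in>K. nonadj x v) - (\<Sum>v\<in>R. k - real (c v) + 1)"
    by (rule sum_subtractf)
  ultimately show ?thesis
    unfolding terms[symmetric] R_def[symmetric] k_def[symmetric] by simp
qed

text \<open>\<open>v\<close> together with its neighbours in \<open>K\<close> is a clique through
  \<open>v\<close>, so \<open>v\<close> has at most \<open>c v - 1\<close> neighbours in
  \<open>K\<close>.\<close>

lemma nonadj_clique_ge:
  assumes "finite V" and "K \<subseteq> V" and "clique K" and "clique_bound V c" and "v \<in> V - K"
  shows "(\<Sum>x\<in>K. nonadj x v) \<ge> real (card K) - real (c v) + 1"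
proof -
  have fin: "finite K" using assms(1,2) finite_subset by blast
  let ?S = "{x\<in>K. adj x v}"
  have "clique (insert v ?S)"
    by (intro clique_insert clique_subset[OF assms(3)]) auto
  then have "card (insert v ?S) \<le> c v"
    using assms(2,4,5)
    by (intro assms(4)[unfolded clique_bound_def, rule_format]) auto
  moreover have "card (insert v ?S) = card ?S + 1"
    using fin assms(5) by simp
  moreover have "card K = card ?S + card {x\<in>K. \<not> adj x v}"
    using card_Un_disjoint[of ?S "{x\<in>K. \<not> adj x v}"] fin
    by (simp add: disjoint_iff Un_def conj_disj_distribL[symmetric])
  ultimately show ?thesis
    by (simp add: sum_nonadj[OF fin])
qed

lemma obtain_maximum_clique:
  assumes "finite V" and "V \<noteq> {}"
  obtains K where "K \<subseteq> V" "clique K" "K \<noteq> {}" "\<And>L. L \<subseteq> V \<Longrightarrow> clique L \<Longrightarrow> card L \<le> card K"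
proof -
  let ?C = "{K. K \<subseteq> V \<and> clique K}"
  have fin: "finite ?C" using assms by simp
  obtain v where "v \<in> V" using assms by blast
  then have v: "{v} \<in> ?C" by (simp add: clique_def)
  have "Max (card ` ?C) \<in> card ` ?C" using fin v by (intro Max_in) auto
  then obtain K where K: "K \<in> ?C" "card K = Max (card ` ?C)" by auto
  have le: "card L \<le> card K" if "L \<in> ?C" for L
    using K that fin by simp
  have "K \<noteq> {}" using le[OF v] by auto
  then show ?thesis using that[of K] K(1) le by simp
qed

lemma deficit_nonneg:
  assumes "finite V" and "clique_bound V c"
  shows "deficit V c \<ge> 0"
  using assms
proof (induction "card V" arbitrary: V c rule: less_induct)
  case less
  show ?case
  proof (cases "V = {}")
    case True
    then show ?thesis by (simp add: deficit_def)
  next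
    case False
    obtain K where K: "K \<subseteq> V" "clique K" "K \<noteq> {}"
      and Kmax: "\<And>L. L \<subseteq> V \<Longrightarrow> clique L \<Longrightarrow> card L \<le> card K"
      using obtain_maximum_clique[OF less.prems(1) False] by metis
    \<comment> \<open>Truncating at the maximum clique size gives \<open>d\<close> the exact value
      \<open>card K\<close> on \<open>K\<close>, as the removal identity requires. It remains a
      clique bound, and it can only lower the deficit.\<close>
    define d where "d v = min (c v) (card K)" for v
    have d: "clique_bound V d"
      using less.prems(2) Kmax unfolding clique_bound_def d_def by simp
    have d1: "d v \<ge> 1" if "v \<in> V" for v
      using clique_bound_pos[OF d that] .
    have dK: "d v = card K" if "v \<in> K" for v
      using less.prems(2) K that unfolding clique_bound_def d_def by (metis min.absorb2)
    have "card (V - K) < card V"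
      using K less.prems(1) by (intro psubset_card_mono) auto
    then have "deficit (V - K) d \<ge> 0"
      using less d clique_bound_subset by (metis Diff_subset finite_Diff)
    moreover have "(real (card K) - real (d v)) * (2 - 1 / real (d v)) \<ge> 0" if "v \<in> V" for v
      using remainder_term_ge[of "d v" "card K"] d1[OF that] by (simp add: d_def)
    then have "(\<Sum>v\<in>V - K. (real (card K) - real (d v)) * (2 - 1 / real (d v))) \<ge> 0"
      by (intro sum_nonneg) auto
    moreover have "(\<Sum>v\<in>V - K. (\<Sum>x\<in>K. nonadj x v) - (real (card K) - real (d v) + 1)) \<ge> 0"
      using nonadj_clique_ge[OF less.prems(1) K(1,2) d]
      by (intro sum_nonneg) (smt (verit))
    ultimately have "deficit V d \<ge> 0"
      using deficit_remove_clique[of V K d] less.prems(1) K dK d1 by simp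
    moreover have "deficit V d \<le> deficit V c"
      using d1 by (intro deficit_mono) (auto simp: d_def)
    ultimately show ?thesis by simp
  qed
qed

end

section \<open>Graphs with small deficit\<close>

text \<open>\<open>bound\<close> and \<open>attained\<close> together make \<open>c v\<close> the
  order of a largest clique through \<open>v\<close>, and \<open>k\<close> is the largest of these
  orders. \<open>small_deficit\<close> is the equality case of the theorem.\<close>

locale tight_graph = symmetric_adjacency adj for adj :: "'a \<Rightarrow> 'a \<Rightarrow> bool" +
  fixes V :: "'a set" and c :: "'a \<Rightarrow> nat" and k :: nat
  assumes finite_V: "finite V"
    and bound: "clique_bound V c"
    and attained: "v \<in> V \<Longrightarrow> \<exists>K\<subseteq>V. v \<in> K \<and> clique K \<and> card K = c v"
    and c_le: "v \<in> V \<Longrightarrow> c v \<le> k"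
    and k_attained: "\<exists>v\<in>V. c v = k"
    and small_deficit: "deficit V c < 2"
begin

definition core :: "'a set" where
  "core = {v\<in>V. c v = k}"

definition max_clique :: "'a set \<Rightarrow> bool" where
  "max_clique K \<longleftrightarrow> K \<subseteq> V \<and> clique K \<and> card K = k"

lemma c_pos: "v \<in> V \<Longrightarrow> 1 \<le> c v"
  using clique_bound_pos[OF bound] .

lemma k_pos: "k \<ge> 1"
  using k_attained c_pos by blast

lemma max_clique_finite: "max_clique K \<Longrightarrow> finite K"
  using finite_V finite_subset by (auto simp: max_clique_def)

lemma max_clique_core:
  assumes "max_clique K"
  shows "K \<subseteq> core"
proof
  fix v assume "v \<in> K"
  moreover from this have "card K \<le> c v"
    using assms by (intro bound[unfolded clique_bound_def, rule_format]) (auto simp: max_clique_def)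
  ultimately show "v \<in> core"
    using assms c_le[of v] by (auto simp: max_clique_def core_def)
qed

lemma core_in_max_clique:
  assumes "v \<in> core"
  obtains K where "max_clique K" "v \<in> K"
  using attained[of v] assms by (auto simp: core_def max_clique_def)

section \<open>Numerical consequences of a deficit below 2\<close>

lemma remainder_ge:
  "v \<in> V \<Longrightarrow> (real k - real (c v)) * (2 - 1 / real (c v)) \<ge> real k - real (c v)"
  using remainder_term_ge[OF c_pos c_le] .

text \<open>In the removal identity the deficit of the rest and both sums are nonnegative, so each
  of them is limited by 2; the second sum enters with the factor 2.\<close>

lemma tight_sums:
  assumes "max_clique K"
  shows "(\<Sum>v\<in>V - K. (real k - real (c v)) * (2 - 1 / real (c v))) < 2" (is "?A < 2")
    and "(\<Sum>v\<in>V - K. (\<Sum>x\<in>K. nonadj x v) - (real k - real (c v) + 1)) < 1" (is "?B < 1")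
proof -
  have K: "K \<subseteq> V" "clique K" "card K = k" "K \<noteq> {}"
    using assms k_pos by (auto simp: max_clique_def)
  have cK: "c v = card K" if "v \<in> K" for v
    using max_clique_core[OF assms] that K by (auto simp: core_def)
  have "deficit V c = deficit (V - K) c + ?A + 2 * ?B"
    using deficit_remove_clique[where V = V and K = K and c = c, OF finite_V K(1,2,4) cK c_pos]
    unfolding K(3) by assumption
  moreover have "deficit (V - K) c \<ge> 0"
    using deficit_nonneg[OF _ clique_bound_subset[OF bound]] finite_V by simp
  moreover have "?A \<ge> 0"
  proof (intro sum_nonneg)
    fix v assume "v \<in> V - K"
    then show "(real k - real (c v)) * (2 - 1 / real (c v)) \<ge> 0"
      using remainder_ge[of v] c_le[of v] by simp
  qed
  moreover have "?B \<ge> 0"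
    using nonadj_clique_ge[OF finite_V K(1,2) bound] K(3) by (intro sum_nonneg) simp
  ultimately show "?A < 2" "?B < 1"
    using small_deficit by linarith+
qed

text \<open>The excess of non-neighbours is a nonnegative integer and a term of a sum below 1, hence
  zero.\<close>

lemma card_nonneighbours:
  assumes "max_clique K" and "v \<in> V - K"
  shows "card {x\<in>K. \<not> adj x v} + c v = k + 1"
proof -
  have K: "K \<subseteq> V" "clique K" "card K = k" "finite K"
    using assms max_clique_finite by (auto simp: max_clique_def)
  let ?e = "\<lambda>v. (\<Sum>x\<in>K. nonadj x v) - (real k - real (c v) + 1)"
  have ge: "?e w \<ge> 0" if "w \<in> V - K" for w
    using nonadj_clique_ge[OF finite_V K(1,2) bound that] K(3) by simp
  have "?e v \<le> (\<Sum>w\<in>V - K. ?e w)"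
    using ge assms finite_V by (intro member_le_sum) auto
  then have "?e v < 1"
    using tight_sums(2)[OF assms(1)] by linarith
  then show ?thesis
    using ge[OF assms(2)] by (simp add: sum_nonadj[OF K(4)])
qed

text \<open>A vertex outside the core adds at least \<open>k - c v\<close>, so at least 1, to a sum
  below 2. This leaves room for one such vertex and for a gap of one.\<close>

lemma outside_core:
  assumes "z \<in> V - core"
  shows "c z + 1 = k" and "V = insert z core"
proof -
  obtain v where "v \<in> core" using k_attained by (auto simp: core_def)
  then obtain K where K: "max_clique K" using core_in_max_clique by metis
  let ?t = "\<lambda>v. (real k - real (c v)) * (2 - 1 / real (c v))"
  have z: "z \<in> V - K" using max_clique_core[OF K] assms by auto
  have nonneg: "?t v \<ge> 0" if "v \<in> V" for v
    using remainder_ge[OF that] c_le[OF that] by linarith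
  have "?t z \<le> (\<Sum>v\<in>V - K. ?t v)"
    using z finite_V nonneg by (intro member_le_sum) auto
  then have "?t z < 2" using tight_sums(1)[OF K] by linarith
  then have "real k - real (c z) < 2" using remainder_ge[of z] z by simp
  then show "c z + 1 = k" using assms c_le[of z] by (auto simp: core_def)
  show "V = insert z core"
  proof (rule ccontr)
    assume "V \<noteq> insert z core"
    then obtain y where y: "y \<in> V - core" "y \<noteq> z" using assms by (auto simp: core_def)
    have "y \<in> V - K" using max_clique_core[OF K] y by auto
    have one: "?t v \<ge> 1" if "v \<in> V - core" for v
    proof -
      have "c v < k" using that c_le[of v] by (auto simp: core_def)
      then have "real k - real (c v) \<ge> 1" by linarith
      then show ?thesis using remainder_ge[of v] that by (metis DiffD1 order_trans)
    qed
    have "?t y + ?t z = (\<Sum>v\<in>{y, z}. ?t v)" using y by simp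
    also have "\<dots> \<le> (\<Sum>v\<in>V - K. ?t v)"
      using z \<open>y \<in> V - K\<close> finite_V nonneg by (intro sum_mono2) auto
    finally show False using one[OF y(1)] one[OF assms] tight_sums(1)[OF K] by linarith
  qed
qed

section \<open>The multipartite structure of the core\<close>

lemma one_nonneighbour:
  assumes "max_clique K" and "v \<in> core"
  shows "\<exists>!x. x \<in> K \<and> \<not> adj x v"
proof (cases "v \<in> K")
  case True
  \<comment> \<open>Within \<open>K\<close> the only non-neighbour of \<open>v\<close> is
    \<open>v\<close> itself.\<close>
  then show ?thesis
    using assms(1) adj_irrefl by (metis clique_def max_clique_def)
next
  case False
  then have "card {x\<in>K. \<not> adj x v} = 1"
    using card_nonneighbours[OF assms(1), of v] assms(2) by (auto simp: core_def)
  then obtain x where "{x\<in>K. \<not> adj x v} = {x}"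
    by (auto simp: card_1_singleton_iff)
  then have "x' \<in> K \<and> \<not> adj x' v \<longleftrightarrow> x' = x" for x' by blast
  then show ?thesis by simp
qed

text \<open>Since \<open>x\<close> is the only non-neighbour of \<open>v\<close> in
  \<open>K\<close>, the vertex \<open>v\<close> is adjacent to all the others.\<close>

lemma max_clique_exchange:
  assumes "max_clique K" and "v \<in> core" and "x \<in> K" and "\<not> adj x v"
  shows "max_clique (insert v (K - {x}))"
proof (cases "v \<in> K")
  case True
  then have "v = x" using assms by (auto simp: max_clique_def clique_def)
  then show ?thesis using assms by (simp add: insert_absorb)
next
  case False
  have "adj y v" if "y \<in> K - {x}" for y
    using one_nonneighbour[OF assms(1,2)] assms that by auto
  then have "clique (insert v (K - {x}))"
    using assms(1) by (intro clique_insert) (auto simp: max_clique_def intro: clique_subset)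
  then show ?thesis
    using assms False k_pos max_clique_finite[OF assms(1)] by (auto simp: max_clique_def core_def)
qed

text \<open>Take a maximum clique through \<open>u\<close> and exchange the non-neighbour of
  \<open>w\<close> for \<open>w\<close>; this vertex is not \<open>u\<close>, so \<open>u\<close>
  stays.\<close>

lemma adj_in_max_clique:
  assumes "u \<in> core" and "w \<in> core" and "adj u w"
  obtains K where "max_clique K" "u \<in> K" "w \<in> K"
proof -
  obtain K where K: "max_clique K" "u \<in> K" using core_in_max_clique assms(1) by metis
  obtain x where x: "x \<in> K" "\<not> adj x w" using one_nonneighbour[OF K(1) assms(2)] by blast
  then have "x \<noteq> u" using assms(3) by blast
  then show ?thesis using that max_clique_exchange[OF K(1) assms(2) x] K by blast
qed

text \<open>Otherwise a maximum clique through \<open>u\<close> and \<open>w\<close> would contain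
  two non-neighbours of \<open>v\<close>.\<close>

lemma nonadj_trans:
  assumes "u \<in> core" "v \<in> core" "w \<in> core" and "\<not> adj u v" "\<not> adj v w"
  shows "\<not> adj u w"
proof
  assume uw: "adj u w"
  then obtain K where K: "max_clique K" "u \<in> K" "w \<in> K" using adj_in_max_clique assms by metis
  have "\<not> adj w v" using assms(5) adj_sym by blast
  then have "u = w" using one_nonneighbour[OF K(1) assms(2)] K assms(4) by blast
  then show False using uw adj_irrefl by simp
qed

text \<open>Non-adjacency is an equivalence relation on the core, and a maximum clique
  \<open>K\<close> is a system of representatives: \<open>p\<close> sends a vertex to its unique
  non-neighbour in \<open>K\<close>.\<close>

lemma obtain_classes:
  obtains K p where "max_clique K" and "p ` core \<subseteq> K"
    and "\<And>x. x \<in> K \<Longrightarrow> p x = x"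
    and "\<And>u v. u \<in> core \<Longrightarrow> v \<in> core \<Longrightarrow> adj u v \<longleftrightarrow> p u \<noteq> p v"
proof -
  obtain v where "v \<in> core" using k_attained by (auto simp: core_def)
  then obtain K where K: "max_clique K" using core_in_max_clique by metis
  define p where "p v = (THE x. x \<in> K \<and> \<not> adj x v)" for v
  have p: "p v \<in> K" "\<not> adj (p v) v" if "v \<in> core" for v
    using theI'[OF one_nonneighbour[OF K that]] unfolding p_def by auto
  have K_core: "K \<subseteq> core" using max_clique_core[OF K] .
  have eq: "p v = x" if "v \<in> core" "x \<in> K" "\<not> adj x v" for v x
    using one_nonneighbour[OF K that(1)] p[OF that(1)] that by blast
  have "adj u v \<longleftrightarrow> p u \<noteq> p v" if uv: "u \<in> core" "v \<in> core" for u v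
  proof
    assume "adj u v"
    then show "p u \<noteq> p v"
      using nonadj_trans[of u "p v" v] p uv K_core adj_sym by (metis subsetD)
  next
    assume "p u \<noteq> p v"
    then show "adj u v"
      using nonadj_trans[of "p u" u v] p uv K_core eq by (metis subsetD)
  qed
  moreover have "p x = x" if "x \<in> K" for x
    using eq[of x x] that K_core adj_irrefl by auto
  moreover have "p ` core \<subseteq> K" using p by auto
  ultimately show ?thesis using that K by blast
qed

text \<open>Every maximum clique contains exactly two non-neighbours of \<open>z\<close>, because
  \<open>c z\<close> is \<open>k - 1\<close>. Exchanging \<open>p v\<close> for \<open>v\<close>
  keeps this number, so \<open>z\<close> treats all members of a class alike.\<close>

lemma outside_core_adj:
  assumes "max_clique K" and "p ` core \<subseteq> K" and "\<And>x. x \<in> K \<Longrightarrow> p x = x"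
    and p: "\<And>u v. u \<in> core \<Longrightarrow> v \<in> core \<Longrightarrow> adj u v \<longleftrightarrow> p u \<noteq> p v"
    and z: "z \<in> V - core"
  obtains x y where "x \<in> K" "y \<in> K" "x \<noteq> y"
    and "\<And>v. v \<in> core \<Longrightarrow> adj v z \<longleftrightarrow> p v \<noteq> x \<and> p v \<noteq> y"
proof -
  have K_core: "L \<subseteq> core" if "max_clique L" for L using max_clique_core[OF that] .
  have two: "card {x\<in>L. \<not> adj x z} = 2" if "max_clique L" for L
  proof -
    have "z \<in> V - L" using K_core[OF that] z by blast
    then show ?thesis using card_nonneighbours[OF that, of z] outside_core(1)[OF z] by linarith
  qed
  obtain x y where xy: "{x\<in>K. \<not> adj x z} = {x, y}" "x \<noteq> y"
    using two[OF assms(1)] by (meson card_2_iff)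
  have same: "adj v z \<longleftrightarrow> adj (p v) z" if v: "v \<in> core" for v
  proof (cases "v \<in> K")
    case True
    then show ?thesis using assms(3) by simp
  next
    case False
    have pv: "p v \<in> K" "p (p v) = p v" using assms v by auto
    then have "\<not> adj (p v) v" using p[of "p v" v] v K_core[OF assms(1)] by auto
    then have L: "max_clique (insert v (K - {p v}))"
      using max_clique_exchange assms(1) v pv by blast
    \<comment> \<open>The non-neighbours of \<open>z\<close> shared by \<open>K\<close> and the
      exchanged clique; its size reveals whether \<open>p v\<close>, respectively \<open>v\<close>,
      is the missing one.\<close>
    let ?S = "{x\<in>K - {p v}. \<not> adj x z}"
    have fin: "finite ?S" using max_clique_finite[OF assms(1)] by simp
    have "{x\<in>K. \<not> adj x z} = (if adj (p v) z then ?S else insert (p v) ?S)"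
      using pv by auto
    then have "card ?S = (if adj (p v) z then 2 else 1)"
      using two[OF assms(1)] fin by (auto split: if_splits)
    moreover have "{x\<in>insert v (K - {p v}). \<not> adj x z} = (if adj v z then ?S else insert v ?S)"
      by auto
    then have "card ?S = (if adj v z then 2 else 1)"
      using two[OF L] fin False by (auto split: if_splits)
    ultimately have "(if adj (p v) z then 2 else 1 :: nat) = (if adj v z then 2 else 1)"
      by (simp only:)
    then show ?thesis by (simp split: if_splits)
  qed
  have "adj v z \<longleftrightarrow> p v \<noteq> x \<and> p v \<noteq> y" if "v \<in> core" for v
  proof -
    have "p v \<in> K" using assms(2) that by blast
    then have "adj (p v) z \<longleftrightarrow> p v \<notin> {x, y}" unfolding xy(1)[symmetric] by simp
    then show ?thesis using same[OF that] by simp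
  qed
  moreover have "x \<in> K" "y \<in> K" using xy by auto
  ultimately show ?thesis using that xy(2) by blast
qed

end

section \<open>Class sizes\<close>

lemma sum_card_classes:
  assumes "finite V" and "finite I" and "p ` V \<subseteq> I"
  shows "(\<Sum>i\<in>I. card {v\<in>V. p v = i}) = card V"
  using sum.group[OF assms, of "\<lambda>_. 1 :: nat"] by simp

text \<open>A class of size a holds a^2 ordered pairs, diagonal included. For a complete
  multipartite graph this is the double sum of \<open>nonadj\<close>.\<close>

lemma sum_same_class:
  assumes "finite V" and "finite I" and "p ` V \<subseteq> I"
  shows "(\<Sum>u\<in>V. \<Sum>v\<in>V. if p u \<noteq> p v then 0 else 1 :: real)
    = (\<Sum>i\<in>I. (real (card {v\<in>V. p v = i}))\<^sup>2)"
proof -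
  have row: "(\<Sum>v\<in>V. if p u \<noteq> p v then 0 else 1 :: real) = real (card {v\<in>V. p v = p u})" for u
    using assms(1) by (simp add: sum.If_cases Int_def eq_commute)
  have "(\<Sum>u\<in>V. real (card {v\<in>V. p v = p u}))
      = (\<Sum>i\<in>I. \<Sum>u\<in>{u\<in>V. p u = i}. real (card {v\<in>V. p v = p u}))"
    by (rule sum.group[OF assms, symmetric])
  also have "\<dots> = (\<Sum>i\<in>I. \<Sum>u\<in>{u\<in>V. p u = i}. real (card {v\<in>V. p v = i}))"
    by (intro sum.cong) auto
  finally show ?thesis by (simp add: row power2_eq_square)
qed

text \<open>On the two values q and q + 1 the square agrees with the linear function (2q + 1) x - q
  (q + 1), so the sum of squares is determined by the sum and the number of terms.\<close>

lemma balanced_sum_squares: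
  fixes f :: "'i \<Rightarrow> nat"
  assumes "\<And>i. i \<in> I \<Longrightarrow> f i = n div r \<or> f i = n div r + 1"
    and "card I = r" and "(\<Sum>i\<in>I. f i) = n"
  shows "real r * (\<Sum>i\<in>I. (real (f i))\<^sup>2) - (real n)\<^sup>2 = real (n mod r) * (real r - real (n mod r))"
proof -
  define q where "q = real (n div r)"
  define s where "s = real (n mod r)"
  have n: "real n = q * real r + s"
    unfolding q_def s_def by (metis of_nat_add of_nat_mult div_mult_mod_eq)
  have "(real (f i))\<^sup>2 = (2 * q + 1) * real (f i) - q * (q + 1)" if "i \<in> I" for i
    using assms(1)[OF that] by (auto simp: q_def power2_eq_square algebra_simps)
  then have "(\<Sum>i\<in>I. (real (f i))\<^sup>2) = (\<Sum>i\<in>I. (2 * q + 1) * real (f i) - q * (q + 1))"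
    by (rule sum.cong[OF refl])
  also have "\<dots> = (2 * q + 1) * real n - real r * (q * (q + 1))"
    using assms(2,3) by (simp add: sum_subtractf sum_distrib_left[symmetric]
      of_nat_sum[symmetric] del: of_nat_sum)
  finally show ?thesis
    unfolding s_def[symmetric] n by (simp add: power2_eq_square algebra_simps)
qed

text \<open>The variance identity, through which a bound on the deficit limits individual deviations
  from the mean.\<close>

lemma sum_square_deviation:
  fixes g :: "'i \<Rightarrow> real"
  assumes "I \<noteq> {}" and "finite I"
  shows "(\<Sum>i\<in>I. (g i - sum g I / real (card I))\<^sup>2) = (\<Sum>i\<in>I. (g i)\<^sup>2) - (sum g I)\<^sup>2 / real (card I)"
proof -
  define m where "m = sum g I / real (card I)"
  have m: "m * real (card I) = sum g I" using assms by (simp add: m_def)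
  have "(\<Sum>i\<in>I. (g i - m)\<^sup>2) = (\<Sum>i\<in>I. (g i)\<^sup>2 - 2 * m * g i + m * m)"
    by (intro sum.cong) (auto simp: power2_eq_square algebra_simps)
  also have "\<dots> = (\<Sum>i\<in>I. (g i)\<^sup>2) - 2 * m * sum g I + m * (m * real (card I))"
    by (simp add: sum.distrib sum_subtractf sum_distrib_left)
  also have "\<dots> = (\<Sum>i\<in>I. (g i)\<^sup>2) - m * sum g I" unfolding m by simp
  finally show ?thesis unfolding m_def by (simp add: power2_eq_square)
qed

text \<open>If two sizes differ by at least 2 and deviate from the mean by a and b, then 2 (a^2 +
  b^2) = (a - b)^2 + (a + b)^2 is at least 4, so this pair alone exhausts the bound 2.\<close>

lemma near_balanced:
  fixes f :: "'i \<Rightarrow> nat"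
  assumes "finite I" and n: "(\<Sum>i\<in>I. f i) = n"
    and less: "(\<Sum>i\<in>I. (real (f i))\<^sup>2) - (real n)\<^sup>2 / real (card I) < 2"
    and ij: "i \<in> I" "j \<in> I"
  shows "f i \<le> f j + 1"
proof (rule ccontr)
  assume "\<not> f i \<le> f j + 1"
  then have ge: "real (f i) - real (f j) \<ge> 2" by simp
  then have "i \<noteq> j" by auto
  define m where "m = real n / real (card I)"
  have n': "(\<Sum>i\<in>I. real (f i)) = real n" using n by (simp flip: of_nat_sum)
  have "(real (f i) - m)\<^sup>2 + (real (f j) - m)\<^sup>2 = (\<Sum>l\<in>{i, j}. (real (f l) - m)\<^sup>2)"
    using \<open>i \<noteq> j\<close> by simp
  also have "\<dots> \<le> (\<Sum>l\<in>I. (real (f l) - m)\<^sup>2)"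
    using assms by (intro sum_mono2) auto
  also have "\<dots> < 2"
  proof -
    have "I \<noteq> {}" using ij by blast
    from sum_square_deviation[OF this \<open>finite I\<close>, of "\<lambda>i. real (f i)"]
    show ?thesis using less unfolding n' m_def by linarith
  qed
  finally have "(real (f i) - m)\<^sup>2 + (real (f j) - m)\<^sup>2 < 2" .
  moreover have "2 * ((real (f i) - m)\<^sup>2 + (real (f j) - m)\<^sup>2)
      = (real (f i) - real (f j))\<^sup>2 + (real (f i) + real (f j) - 2 * m)\<^sup>2"
    by (simp add: power2_eq_square algebra_simps)
  moreover have "(real (f i) - real (f j))\<^sup>2 \<ge> 2\<^sup>2"
    using ge by (intro power_mono) auto
  moreover have "(real (f i) + real (f j) - 2 * m)\<^sup>2 \<ge> 0" by simp
  ultimately show False by simp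
qed

text \<open>All values are \<open>a\<close> or \<open>a + 1\<close> for the minimum
  \<open>a\<close>. As \<open>a\<close> is attained, the total is strictly below
  \<open>card I * (a + 1)\<close>, which makes \<open>a\<close> the quotient.\<close>

lemma balanced_values:
  fixes f :: "'i \<Rightarrow> nat"
  assumes "finite I" and n: "(\<Sum>i\<in>I. f i) = n"
    and le: "\<And>i j. i \<in> I \<Longrightarrow> j \<in> I \<Longrightarrow> f i \<le> f j + 1"
    and i: "i \<in> I"
  shows "f i = n div card I \<or> f i = n div card I + 1"
proof -
  define a where "a = Min (f ` I)"
  have "a \<in> f ` I" unfolding a_def using assms by (intro Min_in) auto
  then obtain j where j: "j \<in> I" "f j = a" by auto
  have ge: "f l \<ge> a" if "l \<in> I" for l unfolding a_def using assms that by simp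
  have up: "f l \<le> a + 1" if "l \<in> I" for l using le[OF that j(1)] j(2) by simp
  have "card I * a \<le> n"
    using sum_bounded_below[of I a f] ge n by simp
  moreover have "n < card I * (a + 1)"
  proof -
    have "(\<Sum>l\<in>I. f l) < (\<Sum>l\<in>I. a + 1)"
      using assms(1) up j by (intro sum_strict_mono_ex1) auto
    then show ?thesis using n by simp
  qed
  ultimately have "n div card I = a"
    by (intro div_nat_eqI) (auto simp: algebra_simps)
  then show ?thesis using ge[OF i] up[OF i] by linarith
qed

section \<open>The integer inequality of the exceptional case\<close>

text \<open>Here \<open>S\<close> and \<open>Y\<close> stand for the sums of \<open>y\<^sup>2\<close> and of \<open>y\<close> over \<open>k\<close> integers, and the
  hypothesis on them is the deficit condition with its denominators cleared.\<close>

lemma exceptional_parameters: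
  fixes k S Y :: int
  assumes "k \<ge> 2" and "Y \<ge> 2" and SY: "S \<ge> Y" and cauchy: "k * S \<ge> Y * Y"
    and less: "S * k * (k - 1) - Y * Y * (k - 1) + Y * (2 * k - 3) < (k + 2) * (k - 1)"
  shows "(k = 2 \<or> k = 3) \<and> S = k \<and> Y = k"
proof -
  \<comment> \<open>By the hypothesis \<open>cauchy\<close> the terms in \<open>S\<close> and
    \<open>Y * Y\<close> are nonnegative together and drop out, leaving a bound on \<open>Y\<close>
    alone.\<close>
  have "(k * S - Y * Y) * (k - 1) \<ge> 0" using assms by simp
  then have Yk: "Y * (2 * k - 3) < (k + 2) * (k - 1)" using less by (simp add: algebra_simps)
  consider "k = 2" | "k = 3" | "k \<ge> 4" using assms by linarith
  then show ?thesis
  proof cases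
    case 1
    then have "Y = 2 \<or> Y = 3" using Yk assms by auto
    then show ?thesis using 1 assms by auto
  next
    case 2
    then have "Y = 2 \<or> Y = 3" using Yk assms by auto
    then show ?thesis using 2 assms by auto
  next
    case 3
    have "Y < k"
    proof (rule ccontr)
      assume "\<not> Y < k"
      then have "k * (2 * k - 3) \<le> Y * (2 * k - 3)" using 3 by (intro mult_right_mono) auto
      then have "k * k < 4 * k - 2" using Yk by (simp add: algebra_simps)
      moreover have "4 * k \<le> k * k" using 3 by (intro mult_right_mono) auto
      ultimately show False by simp
    qed
    \<comment> \<open>Replacing \<open>S\<close> by its lower bound \<open>Y\<close> leaves an
      inequality in \<open>Y\<close> and \<open>k\<close> that fails for all 2 \<le>
      \<open>Y\<close> < \<open>k\<close> with \<open>k\<close> \<ge> 4.\<close>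
    have "Y * k * (k - 1) \<le> S * k * (k - 1)" using 3 SY by (intro mult_right_mono) auto
    then have main: "Y * (k - Y) * (k - 1) + Y * (2 * k - 3) < (k + 2) * (k - 1)"
      using less by (simp add: algebra_simps)
    have kk: "4 * k \<le> k * k" using 3 by (intro mult_right_mono) auto
    consider "Y = 2" | "Y = 3" | "Y \<ge> 4" using assms by linarith
    then show ?thesis
    proof cases
      case 1
      then show ?thesis using main kk 3 by (simp add: algebra_simps)
    next
      case 2
      then show ?thesis using main kk 3 by (simp add: algebra_simps)
    next
      case Y4: 3
      \<comment> \<open>By concavity \<open>Y * (k - Y)\<close> is least at the ends of the range
        from 1 to \<open>k - 1\<close>, where it equals \<open>k - 1\<close>.\<close>
      have "(Y - 1) * (k - Y - 1) \<ge> 0" using Y4 \<open>Y < k\<close> by simp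
      then have "k - 1 \<le> Y * (k - Y)" by (simp add: algebra_simps)
      then have "(k - 1) * (k - 1) \<le> Y * (k - Y) * (k - 1)" using 3 by (intro mult_right_mono) auto
      moreover have "4 * (2 * k - 3) \<le> Y * (2 * k - 3)" using 3 Y4 by (intro mult_right_mono) auto
      ultimately show ?thesis using main 3 by (simp add: algebra_simps)
    qed
  qed
qed

text \<open>For the core together with one vertex of clique number \<open>k - 1\<close>:
  \<open>f\<close> gives the class sizes of the core, \<open>x\<close> and \<open>y\<close> are the
  classes not adjacent to that vertex, and \<open>less\<close> is the deficit condition. After a
  shift of the sizes it depends only on their sum and sum of squares.\<close>

lemma exceptional_class_sizes:
  fixes f :: "'i \<Rightarrow> nat"
  assumes "finite I" and xy: "x \<in> I" "y \<in> I" "x \<noteq> y" and pos: "\<And>i. i \<in> I \<Longrightarrow> f i \<ge> 1"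
    and k: "card I = k"
    and less: "(\<Sum>i\<in>I. (real (f i))\<^sup>2) + 2 * (real (f x) + real (f y)) + 1
      - (real N + 1) * (real N / real k + 1 / (real k - 1)) < 2"
    and N: "N = (\<Sum>i\<in>I. f i)"
  shows "(k = 2 \<or> k = 3) \<and> (\<forall>i\<in>I. f i = (if i = x \<or> i = y then 1 else 2))"
proof -
  \<comment> \<open>Subtracting 1 away from \<open>x\<close> and \<open>y\<close> turns the expected
    sizes, 1 at these two and 2 elsewhere, into the constant 1. Nonempty classes keep
    \<open>g\<close> nonnegative.\<close>
  define g where "g i = (if i = x \<or> i = y then int (f i) else int (f i) - 1)" for i
  define S where "S = (\<Sum>i\<in>I. g i * g i)"
  define Y where "Y = (\<Sum>i\<in>I. g i)"
  define J where "J = I - {x, y}"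
  have I: "I = insert x (insert y J)" "x \<notin> insert y J" "y \<notin> J" "finite J"
    using assms by (auto simp: J_def)
  have kJ: "k = card J + 2" using I k by simp
  have gJ: "g i = int (f i) - 1" if "i \<in> J" for i using that by (auto simp: g_def J_def)
  have split: "sum h I = h x + (h y + sum h J)" for h :: "'i \<Rightarrow> int"
    using I by simp
  have gxy: "g x = int (f x)" "g y = int (f y)" by (simp_all add: g_def)
  have YJ: "Y = int (f x) + (int (f y) + ((\<Sum>i\<in>J. int (f i)) - int (card J)))"
    unfolding Y_def split gxy by (simp add: gJ sum_subtractf)
  have "int N = (\<Sum>i\<in>I. int (f i))" unfolding N by simp
  then have N': "int N = Y + int k - 2"
    unfolding split YJ kJ by simp
  have "(\<Sum>i\<in>J. int (f i) * int (f i)) = (\<Sum>i\<in>J. g i * g i + 2 * g i + 1)"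
    by (intro sum.cong) (auto simp: gJ algebra_simps)
  also have "\<dots> = (\<Sum>i\<in>J. g i * g i) + 2 * (\<Sum>i\<in>J. g i) + int (card J)"
    by (simp add: sum.distrib sum_distrib_left)
  finally have Q: "(\<Sum>i\<in>I. int (f i) * int (f i)) + 2 * (int (f x) + int (f y))
      = S + 2 * Y + int k - 2"
    unfolding S_def Y_def split gxy kJ by simp
  have "(\<Sum>i\<in>I. (real (f i))\<^sup>2) + 2 * (real (f x) + real (f y))
      = of_int ((\<Sum>i\<in>I. int (f i) * int (f i)) + 2 * (int (f x) + int (f y)))"
    by (simp add: power2_eq_square)
  then have Qr: "(\<Sum>i\<in>I. (real (f i))\<^sup>2) + 2 * (real (f x) + real (f y))
      = of_int S + 2 * of_int Y + real k - 2" unfolding Q by simp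
  have Nr: "real N = of_int Y + real k - 2"
    using N' by (metis of_int_add of_int_diff of_int_numeral of_int_of_nat_eq)
  have k2: "real k \<ge> 2" using kJ by simp
  have "of_int S + 2 * of_int Y + real k - 3
      < (of_int Y + real k - 1) * ((of_int Y + real k - 2) / real k + 1 / (real k - 1))"
    using less unfolding Qr Nr by simp
  also have "\<dots> = (of_int Y + real k - 1) * ((of_int Y + real k - 2) * (real k - 1) + real k)
      / (real k * (real k - 1))"
    using k2 by (simp add: field_simps)
  finally have "(of_int S + 2 * of_int Y + real k - 3) * (real k * (real k - 1))
      < (of_int Y + real k - 1) * ((of_int Y + real k - 2) * (real k - 1) + real k)"
    using k2 by (simp add: pos_less_divide_eq)
  then have "of_int ((S + 2 * Y + int k - 3) * (int k * (int k - 1)))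
      < (of_int ((Y + int k - 1) * ((Y + int k - 2) * (int k - 1) + int k)) :: real)"
    by simp
  then have "(S + 2 * Y + int k - 3) * (int k * (int k - 1))
      < (Y + int k - 1) * ((Y + int k - 2) * (int k - 1) + int k)"
    by (simp only: of_int_less_iff)
  then have less': "S * int k * (int k - 1) - Y * Y * (int k - 1) + Y * (2 * int k - 3)
      < (int k + 2) * (int k - 1)"
    by (simp add: algebra_simps)
  have g_ge: "g i \<ge> 0" if "i \<in> I" for i using pos[OF that] by (simp add: g_def)
  have "g i * g i \<ge> g i" for i
    by (cases "g i \<ge> 1") (auto simp: mult_le_cancel_right1 order_trans[OF _ zero_le_square])
  then have "S \<ge> Y" unfolding S_def Y_def by (intro sum_mono)
  moreover have "Y \<ge> 2"
  proof -
    have "(\<Sum>i\<in>J. g i) \<ge> 0" using g_ge I by (intro sum_nonneg) auto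
    then show ?thesis
      using pos[OF xy(1)] pos[OF xy(2)] unfolding Y_def split gxy by linarith
  qed
  moreover have "int k * S \<ge> Y * Y"
  proof -
    \<comment> \<open>Cauchy-Schwarz by expanding the deviations from the mean, scaled by
      \<open>k\<close> to stay in the integers.\<close>
    have "0 \<le> (\<Sum>i\<in>I. (int k * g i - Y) * (int k * g i - Y))" by (intro sum_nonneg) auto
    also have "\<dots> = (\<Sum>i\<in>I. int k * int k * (g i * g i) - 2 * int k * Y * g i + Y * Y)"
      by (intro sum.cong) (auto simp: algebra_simps)
    also have "\<dots> = int k * int k * S - 2 * int k * Y * Y + int k * (Y * Y)"
      unfolding S_def Y_def sum.distrib sum_subtractf sum_distrib_left[symmetric] using k by simp
    also have "\<dots> = int k * (int k * S - Y * Y)" by (simp add: algebra_simps)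
    finally show ?thesis using kJ by (simp add: zero_le_mult_iff)
  qed
  ultimately have res: "(int k = 2 \<or> int k = 3) \<and> S = int k \<and> Y = int k"
    using kJ less' by (intro exceptional_parameters) auto
  \<comment> \<open>Once \<open>S\<close> and \<open>Y\<close> both equal \<open>k\<close>, this sum
    vanishes and forces \<open>g\<close> to be constantly 1.\<close>
  have "(\<Sum>i\<in>I. (g i - 1) * (g i - 1)) = (\<Sum>i\<in>I. g i * g i - 2 * g i + 1)"
    by (intro sum.cong) (auto simp: algebra_simps)
  also have "\<dots> = S - 2 * Y + int k"
    unfolding S_def Y_def sum.distrib sum_subtractf sum_distrib_left[symmetric] using k by simp
  also have "\<dots> = 0" using res by simp
  finally have "(\<Sum>i\<in>I. (g i - 1) * (g i - 1)) = 0" .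
  then have "\<forall>i\<in>I. (g i - 1) * (g i - 1) = 0"
    using assms(1) by (subst (asm) sum_nonneg_eq_0_iff) auto
  then have "f i = (if i = x \<or> i = y then 1 else 2)" if "i \<in> I" for i
    using that by (auto simp: g_def split: if_splits)
  then show ?thesis using res by auto
qed

section \<open>Translation to simple graphs\<close>

definition adjacent :: "'a sgraph \<Rightarrow> 'a \<Rightarrow> 'a \<Rightarrow> bool" where
  "adjacent G u v \<longleftrightarrow> {u, v} \<in> edges G"

lemma doubleton_in_pairs_of: "{u, v} \<in> pairs_of V \<longleftrightarrow> u \<in> V \<and> v \<in> V \<and> u \<noteq> v"
  by (cases "u = v") (auto simp: pairs_of_def)

lemma in_pairs_ofE:
  assumes "e \<in> pairs_of V"
  obtains u v where "e = {u, v}" "u \<in> V" "v \<in> V" "u \<noteq> v"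
proof -
  from assms have "card e = 2" and "e \<subseteq> V" by (auto simp: pairs_of_def)
  then obtain u v where "e = {u, v}" "u \<noteq> v" by (meson card_2_iff)
  then show ?thesis using that \<open>e \<subseteq> V\<close> by auto
qed

lemma adjacent_verts:
  "finite_simple_graph G \<Longrightarrow> adjacent G u v \<Longrightarrow> u \<in> verts G \<and> v \<in> verts G \<and> u \<noteq> v"
  unfolding finite_simple_graph_def adjacent_def by (metis doubleton_in_pairs_of subsetD)

lemma symmetric_adjacency_adjacent:
  assumes "finite_simple_graph G"
  shows "symmetric_adjacency (adjacent G)"
proof
  show "adjacent G u v \<Longrightarrow> adjacent G v u" for u v
    by (simp add: adjacent_def insert_commute)
  show "\<not> adjacent G v v" for v
    using adjacent_verts[OF assms] by blast
qed

text \<open>Handshake argument: the ordered adjacent pairs are grouped by their edge, and each group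
  consists of the two orientations.\<close>

lemma sum_degrees:
  assumes "finite_simple_graph G"
  shows "(\<Sum>u\<in>verts G. card {v\<in>verts G. adjacent G u v}) = 2 * card (edges G)"
proof -
  have fin: "finite (verts G)" and sub: "edges G \<subseteq> pairs_of (verts G)"
    using assms by (auto simp: finite_simple_graph_def)
  have "pairs_of (verts G) \<subseteq> Pow (verts G)" by (auto simp: pairs_of_def)
  then have finE: "finite (edges G)" using sub fin by (meson finite_Pow_iff finite_subset)
  let ?P = "SIGMA u:verts G. {v\<in>verts G. adjacent G u v}"
  have finP: "finite ?P" using fin by auto
  have "(\<Sum>u\<in>verts G. card {v\<in>verts G. adjacent G u v}) = card ?P"
    using fin by simp
  also have "\<dots> = (\<Sum>e\<in>edges G. card {q\<in>?P. {fst q, snd q} = e})"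
    by (rule sum_card_classes[symmetric]) (use finP finE in \<open>auto simp: adjacent_def\<close>)
  also have "\<dots> = (\<Sum>e\<in>edges G. 2)"
  proof (intro sum.cong refl)
    fix e assume e: "e \<in> edges G"
    then obtain u v where uv: "e = {u, v}" "u \<in> verts G" "v \<in> verts G" "u \<noteq> v"
      using sub in_pairs_ofE by (metis subsetD)
    then have "{q\<in>?P. {fst q, snd q} = e} = {(u, v), (v, u)}"
      using e by (auto simp: adjacent_def doubleton_eq_iff insert_commute)
    then show "card {q\<in>?P. {fst q, snd q} = e} = 2" using uv by simp
  qed
  finally show ?thesis by simp
qed

text \<open>The double sum of \<open>nonadj\<close> is n^2 minus the degree sum, that is n^2 - 2
  |E|, and (c - 1)/c = 1 - 1/c.\<close>

lemma edge_bound_minus_edges: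
  assumes "finite_simple_graph G" and "\<And>v. v \<in> verts G \<Longrightarrow> c v \<ge> 1"
  shows "real (card (verts G)) / 2 * (\<Sum>v\<in>verts G. (real (c v) - 1) / real (c v))
    = real (card (edges G)) + symmetric_adjacency.deficit (adjacent G) (verts G) c / 2"
proof -
  interpret symmetric_adjacency "adjacent G"
    using symmetric_adjacency_adjacent[OF assms(1)] .
  have fin: "finite (verts G)" using assms by (simp add: finite_simple_graph_def)
  let ?n = "real (card (verts G))"
  have "(\<Sum>v\<in>verts G. nonadj u v) = ?n - real (card {v\<in>verts G. adjacent G u v})" for u
  proof -
    have "nonadj u v = 1 - (if adjacent G u v then 1 else 0)" for v
      by (simp add: nonadj_def)
    then show ?thesis
      using fin by (simp add: sum_subtractf sum.If_cases Int_def)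
  qed
  then have "(\<Sum>u\<in>verts G. \<Sum>v\<in>verts G. nonadj u v)
      = ?n * ?n - real (\<Sum>u\<in>verts G. card {v\<in>verts G. adjacent G u v})"
    by (simp add: sum_subtractf)
  also have "\<dots> = ?n * ?n - 2 * real (card (edges G))"
    unfolding sum_degrees[OF assms(1)] by simp
  finally have D: "deficit (verts G) c = ?n * ?n - 2 * real (card (edges G))
      - ?n * (\<Sum>v\<in>verts G. 1 / real (c v))"
    by (simp add: deficit_def)
  have "(\<Sum>v\<in>verts G. (real (c v) - 1) / real (c v)) = (\<Sum>v\<in>verts G. 1 - 1 / real (c v))"
    using assms(2) by (intro sum.cong) (force simp: field_simps)+
  also have "\<dots> = ?n - (\<Sum>v\<in>verts G. 1 / real (c v))"
    by (simp add: sum_subtractf)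
  finally have C: "(\<Sum>v\<in>verts G. (real (c v) - 1) / real (c v))
      = ?n - (\<Sum>v\<in>verts G. 1 / real (c v))" .
  show ?thesis unfolding C D by (simp add: field_simps)
qed

text \<open>A complete subgraph, induced or not, forces all edges between its vertices into
  \<open>G\<close>. Subgraphs can thus be replaced by vertex sets in the clique number.\<close>

lemma subgraph_complete_iff_clique:
  assumes "finite_simple_graph G"
  shows "(\<exists>H. subgraph H G \<and> v \<in> verts H \<and> H \<simeq>\<^sub>G complete_graph k) \<longleftrightarrow>
    (\<exists>K\<subseteq>verts G. v \<in> K \<and> symmetric_adjacency.clique (adjacent G) K \<and> card K = k)"
    (is "?L \<longleftrightarrow> ?R")
proof -
  interpret symmetric_adjacency "adjacent G"
    using symmetric_adjacency_adjacent[OF assms] .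
  show ?thesis
  proof
    assume ?L
    then obtain H f where H: "subgraph H G" "v \<in> verts H"
      and f: "bij_betw f (verts H) {..<k}"
      and fe: "\<And>u w. u \<in> verts H \<Longrightarrow> w \<in> verts H \<Longrightarrow>
        {u, w} \<in> edges H \<longleftrightarrow> {f u, f w} \<in> pairs_of {..<k}"
      unfolding graph_iso_def complete_graph_def by auto
    have "{u, w} \<in> edges H" if "u \<in> verts H" "w \<in> verts H" "u \<noteq> w" for u w
      using fe[OF that(1,2)] f that
      by (auto simp: doubleton_in_pairs_of bij_betw_def inj_on_def)
    then have "clique (verts H)"
      using H(1) unfolding clique_def adjacent_def subgraph_def by blast
    moreover have "card (verts H) = k" using bij_betw_same_card[OF f] by simp
    ultimately show ?R using H unfolding subgraph_def by blast
  next
    assume ?R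
    then obtain K where K: "K \<subseteq> verts G" "v \<in> K" "clique K" "card K = k" by blast
    have fin: "finite K" using K(1) assms finite_subset by (auto simp: finite_simple_graph_def)
    then obtain f where f: "bij_betw f K {..<k}"
      using K(4) ex_bij_betw_finite_nat[OF fin] by (auto simp: lessThan_atLeast0)
    let ?H = "SGraph K (pairs_of K)"
    have "pairs_of K \<subseteq> edges G"
    proof
      fix e assume "e \<in> pairs_of K"
      then obtain u w where "e = {u, w}" "u \<in> K" "w \<in> K" "u \<noteq> w" by (rule in_pairs_ofE)
      then show "e \<in> edges G" using K(3) by (auto simp: clique_def adjacent_def)
    qed
    then have "subgraph ?H G" using K by (simp add: subgraph_def)
    moreover have "?H \<simeq>\<^sub>G complete_graph k"
      unfolding graph_iso_def complete_graph_def sgraph.sel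
      using f by (intro exI[of _ f]) (auto simp: doubleton_in_pairs_of bij_betw_def inj_on_def)
    ultimately show ?L using K(2) by (metis sgraph.sel(1))
  qed
qed

lemma clique_number_at_clique_bound:
  assumes "finite_simple_graph G"
  shows "symmetric_adjacency.clique_bound (adjacent G) (verts G) (clique_number_at G)"
    and "v \<in> verts G \<Longrightarrow> \<exists>K\<subseteq>verts G. v \<in> K \<and>
      symmetric_adjacency.clique (adjacent G) K \<and> card K = clique_number_at G v"
proof -
  interpret symmetric_adjacency "adjacent G"
    using symmetric_adjacency_adjacent[OF assms] .
  have fin: "finite (verts G)" using assms by (simp add: finite_simple_graph_def)
  let ?P = "\<lambda>v k. \<exists>K\<subseteq>verts G. v \<in> K \<and> clique K \<and> card K = k"
  have c: "clique_number_at G v = (GREATEST k. ?P v k)" for v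
    unfolding clique_number_at_def subgraph_complete_iff_clique[OF assms] ..
  \<comment> \<open>Boundedness of the candidate orders, on which the meaning of
    \<open>GREATEST\<close> rests.\<close>
  have le: "k \<le> card (verts G)" if "?P v k" for v k
    using that fin card_mono by blast
  have "card K \<le> clique_number_at G v" if "K \<subseteq> verts G" "clique K" "v \<in> K" for K v
    unfolding c using that le by (intro Greatest_le_nat[where b = "card (verts G)"]) blast+
  then show "clique_bound (verts G) (clique_number_at G)"
    unfolding clique_bound_def by blast
  assume "v \<in> verts G"
  then have "?P v 1" by (intro exI[of _ "{v}"]) (auto simp: clique_def)
  then show "?P v (clique_number_at G v)"
    unfolding c using le by (intro GreatestI_nat[where P = "?P v" and b = "card (verts G)"]) blast+
qed

text \<open>An isomorphism carries cliques to cliques, so \<open>d\<close> pulled back majorises the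
  clique numbers of \<open>G\<close>, and the deficit is monotone. To bound the deficit of an
  extremal graph it suffices to exhibit a clique bound on its model.\<close>

lemma deficit_iso_le:
  assumes G: "finite_simple_graph G" and H: "finite_simple_graph H" and "G \<simeq>\<^sub>G H"
    and d: "symmetric_adjacency.clique_bound (adjacent H) (verts H) d"
  shows "symmetric_adjacency.deficit (adjacent G) (verts G) (clique_number_at G)
    \<le> symmetric_adjacency.deficit (adjacent H) (verts H) d"
proof -
  interpret G: symmetric_adjacency "adjacent G" using symmetric_adjacency_adjacent[OF G] .
  interpret H: symmetric_adjacency "adjacent H" using symmetric_adjacency_adjacent[OF H] .
  obtain f where f: "bij_betw f (verts G) (verts H)"
    and fe: "\<And>u v. u \<in> verts G \<Longrightarrow> v \<in> verts G \<Longrightarrow> adjacent G u v \<longleftrightarrow> adjacent H (f u) (f v)"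
    using assms(3) unfolding graph_iso_def adjacent_def by auto
  have le: "clique_number_at G v \<le> d (f v)" if v: "v \<in> verts G" for v
  proof -
    obtain K where K: "K \<subseteq> verts G" "v \<in> K" "G.clique K" "card K = clique_number_at G v"
      using clique_number_at_clique_bound(2)[OF G v] by blast
    have inj: "inj_on f K" using f K(1) by (auto simp: bij_betw_def inj_on_def)
    have "H.clique (f ` K)"
      using K(1,3) fe unfolding G.clique_def H.clique_def by (auto, metis subsetD)
    moreover have "f ` K \<subseteq> verts H" using f K(1) by (auto simp: bij_betw_def)
    ultimately have "card (f ` K) \<le> d (f v)"
      using K(2) d unfolding H.clique_bound_def by blast
    then show ?thesis using K(4) card_image[OF inj] by simp
  qed
  have "G.deficit (verts G) (clique_number_at G) \<le> G.deficit (verts G) (d \<circ> f)"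
    using le G.clique_bound_pos[OF clique_number_at_clique_bound(1)[OF G]]
    by (intro G.deficit_mono) auto
  also have "\<dots> = H.deficit (verts H) d"
  proof -
    have "(\<Sum>u\<in>verts H. \<Sum>v\<in>verts H. H.nonadj u v)
        = (\<Sum>u\<in>verts G. \<Sum>v\<in>verts G. H.nonadj (f u) (f v))"
      by (simp add: sum.reindex_bij_betw[OF f, symmetric])
    also have "\<dots> = (\<Sum>u\<in>verts G. \<Sum>v\<in>verts G. G.nonadj u v)"
      by (intro sum.cong refl) (simp add: G.nonadj_def H.nonadj_def fe)
    finally show ?thesis
      unfolding G.deficit_def H.deficit_def
      by (simp add: sum.reindex_bij_betw[OF f, symmetric] bij_betw_same_card[OF f])
  qed
  finally show ?thesis .
qed

section \<open>The extremal graphs\<close>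

text \<open>For \<open>s\<close> > 2 both conditions say r (s - 2) < s^2; for \<open>s\<close> \<le>
  2 the inequality on the left holds outright.\<close>

lemma remainder_condition_iff:
  fixes r s :: nat
  assumes "s < r"
  shows "real s * (real r - real s) < 2 * real r \<longleftrightarrow> s \<le> 2 \<or> real r < (real s)\<^sup>2 / (real s - 2)"
proof (cases "s \<le> 2")
  case True
  then consider "s = 0" | "s = 1" | "s = 2" by linarith
  then show ?thesis using assms by cases auto
next
  case False
  then show ?thesis by (simp add: pos_less_divide_eq power2_eq_square algebra_simps)
qed

lemma floor_ceiling_of_nat_divide:
  fixes n r :: nat
  assumes "r > 0"
  shows "\<lfloor>real n / real r\<rfloor> = int (n div r)"
    and "\<lceil>real n / real r\<rceil> = (if n mod r = 0 then int (n div r) else int (n div r) + 1)"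
proof -
  show fl: "\<lfloor>real n / real r\<rfloor> = int (n div r)"
    by (simp add: floor_divide_of_nat_eq)
  have "real n / real r = real (n div r) + real (n mod r) / real r"
    using assms by (simp add: field_simps flip: of_nat_mult of_nat_add)
  then show "\<lceil>real n / real r\<rceil> = (if n mod r = 0 then int (n div r) else int (n div r) + 1)"
    using assms by (auto simp: ceiling_eq_iff)
qed

text \<open>A proper colouring is injective on a clique. The clique bounds of the model graphs come
  from this.\<close>

lemma (in symmetric_adjacency) clique_card_le_colours:
  assumes "clique K" and "finite C" and "h ` K \<subseteq> C"
    and "\<And>u v. u \<in> K \<Longrightarrow> v \<in> K \<Longrightarrow> adj u v \<Longrightarrow> h u \<noteq> h v"
  shows "card K \<le> card C"
proof -
  have "inj_on h K"
    using assms(1,4) unfolding inj_on_def clique_def by blast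
  then show ?thesis using card_inj_on_le assms(2,3) by blast
qed

section \<open>Turan graphs and the class S\<close>

lemma turan_adjacent:
  assumes "edges T = {{u, v} | u v. u \<in> verts T \<and> v \<in> verts T \<and> p u \<noteq> p v}"
  shows "adjacent T u v \<longleftrightarrow> u \<in> verts T \<and> v \<in> verts T \<and> p u \<noteq> p v"
  unfolding adjacent_def assms by (auto simp: doubleton_eq_iff)

text \<open>The classes are a proper colouring with \<open>r\<close> colours, so the constant
  \<open>r\<close> is a clique bound, also when \<open>r\<close> exceeds \<open>n\<close>. With it,
  \<open>r\<close> times the deficit is s (r - s) for the remainder s, and the condition on s puts
  this below 2 r.\<close>

lemma in_class_S_deficit:
  assumes G: "finite_simple_graph G" and S: "in_class_S G"
  shows "symmetric_adjacency.deficit (adjacent G) (verts G) (clique_number_at G) < 2"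
proof -
  obtain n r and T :: "nat sgraph" where n: "n > 0" and r: "r > 0" and T: "is_turan_graph n r T"
    and iso: "G \<simeq>\<^sub>G T" and cond: "n mod r \<le> 2 \<or> real r < (real (n mod r))\<^sup>2 / (real (n mod r) - 2)"
    using S unfolding in_class_S_def by blast
  obtain p where fin: "finite (verts T)" and card: "card (verts T) = n"
    and p: "p ` verts T \<subseteq> {..<r}"
    and sizes: "\<forall>i<r. int (card {v\<in>verts T. p v = i}) \<in> {\<lceil>real n / real r\<rceil>, \<lfloor>real n / real r\<rfloor>}"
    and E: "edges T = {{u, v} | u v. u \<in> verts T \<and> v \<in> verts T \<and> p u \<noteq> p v}"
    using T unfolding is_turan_graph_def by (elim conjE exE) (rule that)
  note adj = turan_adjacent[OF E]
  have simple: "finite_simple_graph T"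
    unfolding finite_simple_graph_def using fin by (auto simp: E doubleton_in_pairs_of)
  interpret symmetric_adjacency "adjacent T" using symmetric_adjacency_adjacent[OF simple] .
  have "card K \<le> r" if "clique K" "K \<subseteq> verts T" for K
    using clique_card_le_colours[OF that(1), of "{..<r}" p] that(2) p adj by auto
  then have "clique_bound (verts T) (\<lambda>_. r)"
    unfolding clique_bound_def by blast
  then have "symmetric_adjacency.deficit (adjacent G) (verts G) (clique_number_at G)
      \<le> deficit (verts T) (\<lambda>_. r)"
    using deficit_iso_le[OF G simple iso] by blast
  also have "\<dots> < 2"
  proof -
    let ?f = "\<lambda>i. card {v\<in>verts T. p v = i}"
    have val: "?f i = n div r \<or> ?f i = n div r + 1" if "i \<in> {..<r}" for i
    proof -
      have "int (?f i) \<in> {\<lceil>real n / real r\<rceil>, \<lfloor>real n / real r\<rfloor>}" using sizes that by simp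
      then show ?thesis
        unfolding floor_ceiling_of_nat_divide[OF r] by (auto split: if_splits)
    qed
    have "(\<Sum>u\<in>verts T. \<Sum>v\<in>verts T. nonadj u v)
        = (\<Sum>u\<in>verts T. \<Sum>v\<in>verts T. if p u \<noteq> p v then 0 else 1)"
      by (intro sum.cong refl) (simp add: nonadj_def adj)
    also have "\<dots> = (\<Sum>i<r. (real (?f i))\<^sup>2)"
      using sum_same_class[OF fin _ p] by simp
    finally have "deficit (verts T) (\<lambda>_. r) = (\<Sum>i<r. (real (?f i))\<^sup>2) - (real n)\<^sup>2 / real r"
      unfolding deficit_def by (simp add: card power2_eq_square)
    then have "real r * deficit (verts T) (\<lambda>_. r) = real r * (\<Sum>i<r. (real (?f i))\<^sup>2) - (real n)\<^sup>2"
      using r by (simp add: right_diff_distrib)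
    also have "\<dots> = real (n mod r) * (real r - real (n mod r))"
      using sum_card_classes[OF fin _ p] card val by (intro balanced_sum_squares) auto
    also have "\<dots> < real r * 2"
      using remainder_condition_iff[of "n mod r" r] cond r by simp
    finally show ?thesis using r by (simp only: mult_less_cancel_left_pos of_nat_0_less_iff)
  qed
  finally show ?thesis .
qed

text \<open>The model in \<open>in_class_S\<close> has natural numbers as vertices and classes
  indexed by \<open>{..<r}\<close>; the bijections \<open>h\<close> and \<open>g\<close> rename
  vertices and classes accordingly.\<close>

lemma balanced_classes_in_class_S:
  assumes fin: "finite (verts G)" and n: "card (verts G) = n" "n > 0"
    and I: "finite I" "card I = r" "r > 0" and p: "p ` verts G \<subseteq> I"
    and sizes: "\<And>i. i \<in> I \<Longrightarrow> card {v\<in>verts G. p v = i} = n div r \<or>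
      card {v\<in>verts G. p v = i} = n div r + 1"
    and adj: "\<And>u v. u \<in> verts G \<Longrightarrow> v \<in> verts G \<Longrightarrow> {u, v} \<in> edges G \<longleftrightarrow> p u \<noteq> p v"
    and cond: "real (n mod r) * (real r - real (n mod r)) < 2 * real r"
  shows "in_class_S G"
proof -
  obtain h where h: "bij_betw h (verts G) {..<n}"
    using ex_bij_betw_finite_nat[OF fin] n by (auto simp: lessThan_atLeast0)
  obtain g where g: "bij_betw g I {..<r}"
    using ex_bij_betw_finite_nat[OF I(1)] I by (auto simp: lessThan_atLeast0)
  define q where "q m = g (p (inv_into (verts G) h m))" for m
  have qh: "q (h v) = g (p v)" if "v \<in> verts G" for v
    using that h by (simp add: q_def bij_betw_inv_into_left)
  have hV: "h ` verts G = {..<n}" using h by (simp add: bij_betw_def)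
  define T where "T = SGraph {..<n} {{u, v} | u v. u \<in> {..<n} \<and> v \<in> {..<n} \<and> q u \<noteq> q v}"
  have T: "verts T = {..<n}" "edges T = {{u, v} | u v. u \<in> verts T \<and> v \<in> verts T \<and> q u \<noteq> q v}"
    by (simp_all add: T_def)
  have q_eq: "q (h u) = q (h v) \<longleftrightarrow> p u = p v" if "u \<in> verts G" "v \<in> verts G" for u v
    using that g p by (simp add: qh) (metis bij_betw_def image_subset_iff inj_on_eq_iff)
  have "G \<simeq>\<^sub>G T"
    unfolding graph_iso_def
  proof (intro exI conjI ballI)
    show "bij_betw h (verts G) (verts T)" using h T by simp
    fix u v assume uv: "u \<in> verts G" "v \<in> verts G"
    then have "h u \<in> verts T" "h v \<in> verts T" using hV T by auto
    then show "{u, v} \<in> edges G \<longleftrightarrow> {h u, h v} \<in> edges T"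
      using turan_adjacent[OF T(2), of "h u" "h v"] q_eq[OF uv] adj[OF uv] by (simp add: adjacent_def)
  qed
  moreover have "is_turan_graph n r T"
    unfolding is_turan_graph_def
  proof (intro conjI exI allI impI)
    show "finite (verts T)" "card (verts T) = n" using T by auto
    show "q ` verts T \<subseteq> {..<r}"
      unfolding T hV[symmetric] using qh p g by (auto simp: bij_betw_def)
    show "edges T = {{u, v} | u v. u \<in> verts T \<and> v \<in> verts T \<and> q u \<noteq> q v}" by (rule T(2))
    have total: "(\<Sum>i\<in>I. card {v\<in>verts G. p v = i}) = n"
      using sum_card_classes[OF fin I(1) p] n by simp
    fix i assume "i < r"
    then obtain j where j: "j \<in> I" "g j = i" using g by (metis bij_betw_def imageE lessThan_iff)
    have "{m\<in>verts T. q m = i} = h ` {v\<in>verts G. p v = j}"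
    proof -
      have "q (h v) = i \<longleftrightarrow> p v = j" if "v \<in> verts G" for v
        using that g p j qh by (metis bij_betw_def image_subset_iff inj_on_eq_iff)
      then show ?thesis unfolding T(1) hV[symmetric] by blast
    qed
    moreover have "inj_on h {v\<in>verts G. p v = j}"
      using h by (auto simp: bij_betw_def inj_on_def)
    ultimately have c: "card {m\<in>verts T. q m = i} = card {v\<in>verts G. p v = j}"
      by (simp add: card_image)
    \<comment> \<open>If \<open>r\<close> divides \<open>n\<close>, ceiling and floor coincide, so
      the larger size has to be excluded: a single class of that size would push the total above
      \<open>n\<close>.\<close>
    have "card {v\<in>verts G. p v = j} = n div r" if "n mod r = 0"
    proof (rule ccontr)
      assume "card {v\<in>verts G. p v = j} \<noteq> n div r"
      then have "(\<Sum>i\<in>I. n div r) < (\<Sum>i\<in>I. card {v\<in>verts G. p v = i})"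
      proof (intro sum_strict_mono_ex1 I(1) ballI bexI[OF _ j(1)])
        show "n div r \<le> card {v\<in>verts G. p v = i}" if "i \<in> I" for i
          using sizes[OF that] by linarith
        show "n div r < card {v\<in>verts G. p v = j}"
          using sizes[OF j(1)] \<open>card {v\<in>verts G. p v = j} \<noteq> n div r\<close> by linarith
      qed
      moreover have "r * (n div r) = n" using that by auto
      ultimately show False using total I(2) by simp
    qed
    then show "int (card {m\<in>verts T. q m = i}) \<in> {\<lceil>real n / real r\<rceil>, \<lfloor>real n / real r\<rfloor>}"
      unfolding c floor_ceiling_of_nat_divide[OF I(3)] using sizes[OF j(1)] by auto
  qed
  moreover have "n mod r \<le> 2 \<or> real r < (real (n mod r))\<^sup>2 / (real (n mod r) - 2)"
    using remainder_condition_iff[of "n mod r" r] cond I(3) by simp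
  ultimately show ?thesis
    unfolding in_class_S_def using n I by blast
qed

section \<open>The exceptional graphs Y and X\<close>

lemma verts_graph_Y: "verts graph_Y = {0, 1, 2}"
  by (auto simp: graph_Y_def complement_graph_def path_graph_def less_Suc_eq
    numeral_3_eq_3 numeral_2_eq_2)

lemma edges_path_2: "edges (path_graph 2) = {{0, 1}}"
  by (auto simp: path_graph_def less_Suc_eq numeral_2_eq_2)

lemma edges_path_3: "edges (path_graph 3) = {{0, 1}, {1, 2}}"
  by (auto simp: path_graph_def less_Suc_eq numeral_3_eq_3 numeral_2_eq_2)

lemma adjacent_graph_Y:
  "adjacent graph_Y u v \<longleftrightarrow> (u = 0 \<and> v = 2) \<or> (u = 2 \<and> v = 0)"
proof -
  have "adjacent graph_Y u v \<longleftrightarrow> {u, v} \<in> pairs_of {0, 1, 2} \<and> {u, v} \<notin> {{0, 1}, {1, 2}}"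
    using verts_graph_Y
    by (simp add: adjacent_def graph_Y_def complement_graph_def edges_path_3)
  then have eq: "adjacent graph_Y u v \<longleftrightarrow> (u \<in> {0, 1, 2} \<and> v \<in> {0, 1, 2} \<and> u \<noteq> v) \<and>
      {u, v} \<notin> {{0, 1}, {1, 2}}"
    unfolding doubleton_in_pairs_of .
  show ?thesis
  proof (cases "u \<in> {0, 1, 2} \<and> v \<in> {0, 1, 2}")
    case True
    then have "u = 0 \<or> u = 1 \<or> u = 2" "v = 0 \<or> v = 1 \<or> v = 2" by simp_all
    then show ?thesis unfolding eq by (elim disjE) (simp_all add: doubleton_eq_iff)
  next
    case False
    then show ?thesis unfolding eq by auto
  qed
qed

lemma verts_graph_X: "verts graph_X = {Inl 0, Inl 1, Inr 0, Inr 1, Inr 2}"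
  by (auto simp: graph_X_def complement_graph_def path_graph_def disjoint_union_def
    less_Suc_eq numeral_3_eq_3 numeral_2_eq_2)

text \<open>\<open>Inr 1\<close> is the middle of the three-vertex path, so in the complement it is
  adjacent only to the two \<open>Inl\<close> vertices, which are not adjacent to each
  other.\<close>

lemma adjacent_graph_X:
  "adjacent graph_X u v \<longleftrightarrow> u \<in> verts graph_X \<and> v \<in> verts graph_X \<and> u \<noteq> v \<and>
    \<not> (\<exists>a b. u = Inl a \<and> v = Inl b) \<and>
    \<not> (u = Inr 1 \<and> (\<exists>b. v = Inr b)) \<and> \<not> (v = Inr 1 \<and> (\<exists>a. u = Inr a))"
proof -
  have "adjacent graph_X u v \<longleftrightarrow> {u, v} \<in> pairs_of (verts graph_X) \<and>
      {u, v} \<notin> {{Inl 0, Inl 1}, {Inr 0, Inr 1}, {Inr 1, Inr 2}}"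
    by (simp add: adjacent_def graph_X_def complement_graph_def disjoint_union_def
      edges_path_2 edges_path_3 conj_ac)
  then have eq: "adjacent graph_X u v \<longleftrightarrow> (u \<in> verts graph_X \<and> v \<in> verts graph_X \<and> u \<noteq> v) \<and>
      {u, v} \<notin> {{Inl 0, Inl 1}, {Inr 0, Inr 1}, {Inr 1, Inr 2}}"
    unfolding doubleton_in_pairs_of .
  show ?thesis
  proof (cases "u \<in> verts graph_X \<and> v \<in> verts graph_X")
    case True
    then have "u = Inl 0 \<or> u = Inl 1 \<or> u = Inr 0 \<or> u = Inr 1 \<or> u = Inr 2"
      "v = Inl 0 \<or> v = Inl 1 \<or> v = Inr 0 \<or> v = Inr 1 \<or> v = Inr 2"
      by (simp_all add: verts_graph_X)
    then show ?thesis
      unfolding eq by (elim disjE) (simp_all add: doubleton_eq_iff verts_graph_X)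
  next
    case False
    then show ?thesis unfolding eq by blast
  qed
qed

lemma finite_simple_graph_complement:
  "finite (verts G) \<Longrightarrow> finite_simple_graph (complement_graph G)"
  by (auto simp: finite_simple_graph_def complement_graph_def)

lemma finite_simple_graph_X: "finite_simple_graph graph_X"
  unfolding graph_X_def
  by (rule finite_simple_graph_complement) (simp add: disjoint_union_def path_graph_def)

lemma finite_simple_graph_Y: "finite_simple_graph graph_Y"
  unfolding graph_Y_def
  by (rule finite_simple_graph_complement) (simp add: path_graph_def)

lemma graph_Y_deficit:
  assumes G: "finite_simple_graph G" and iso: "G \<simeq>\<^sub>G graph_Y"
  shows "symmetric_adjacency.deficit (adjacent G) (verts G) (clique_number_at G) < 2"
proof -
  interpret symmetric_adjacency "adjacent graph_Y"
    using symmetric_adjacency_adjacent[OF finite_simple_graph_Y] .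
  \<comment> \<open>Vertex 1 is the middle of the path and hence isolated in the complement.\<close>
  define d :: "nat \<Rightarrow> nat" where "d v = (if v = 1 then 1 else 2)" for v
  have "clique_bound (verts graph_Y) d"
    unfolding clique_bound_def
  proof (intro allI impI)
    fix K v assume K: "K \<subseteq> verts graph_Y" "clique K" "v \<in> K"
    show "card K \<le> d v"
    proof (cases "v = 1")
      case True
      have "\<not> adjacent graph_Y 1 u" for u by (simp add: adjacent_graph_Y)
      then have "u = 1" if "u \<in> K" for u
        using K(2)[unfolded clique_def, rule_format, of 1 u] K(3) True that by metis
      then have "K \<subseteq> {1}" by blast
      then show ?thesis using card_mono[of "{1}" K] True by (simp add: d_def)
    next
      case False
      have "card K \<le> card {0, 2 :: nat}"
        using K by (intro clique_card_le_colours[of _ _ "\<lambda>v. if v = 2 then 2 else 0"])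
          (auto simp: adjacent_graph_Y)
      then show ?thesis using False by (simp add: d_def)
    qed
  qed
  then have "symmetric_adjacency.deficit (adjacent G) (verts G) (clique_number_at G)
      \<le> deficit (verts graph_Y) d"
    using deficit_iso_le[OF G finite_simple_graph_Y iso] by blast
  also have "\<dots> = 1"
    by (simp add: deficit_def verts_graph_Y nonadj_def adjacent_graph_Y d_def)
  finally show ?thesis by simp
qed

lemma graph_X_deficit:
  assumes G: "finite_simple_graph G" and iso: "G \<simeq>\<^sub>G graph_X"
  shows "symmetric_adjacency.deficit (adjacent G) (verts G) (clique_number_at G) < 2"
proof -
  interpret symmetric_adjacency "adjacent graph_X"
    using symmetric_adjacency_adjacent[OF finite_simple_graph_X] .
  define d :: "nat + nat \<Rightarrow> nat" where "d v = (if v = Inr 1 then 2 else 3)" for v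
  \<comment> \<open>A proper 3-colouring in which \<open>Inr 1\<close> shares its colour with
    \<open>Inr 0\<close>. The third colour is used by \<open>Inr 2\<close> only, a non-neighbour of
    \<open>Inr 1\<close>, so cliques through \<open>Inr 1\<close> see just two colours.\<close>
  define h :: "nat + nat \<Rightarrow> nat" where
    "h v = (if v = Inr 0 \<or> v = Inr 1 then 1 else if v = Inr 2 then 2 else 0)" for v
  have h: "h u \<noteq> h v" if "adjacent graph_X u v" for u v
    using that by (auto simp: adjacent_graph_X verts_graph_X h_def)
  have "clique_bound (verts graph_X) d"
    unfolding clique_bound_def
  proof (intro allI impI)
    fix K v assume K: "K \<subseteq> verts graph_X" "clique K" "v \<in> K"
    show "card K \<le> d v"
    proof (cases "v = Inr 1")
      case True
      have "adjacent graph_X (Inr 1) u" if "u \<in> K" "u \<noteq> Inr 1" for u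
        using K that True by (auto simp: clique_def)
      then have "Inr 2 \<notin> K" by (force simp: adjacent_graph_X)
      then have "card K \<le> card {0, 1 :: nat}"
        using K h by (intro clique_card_le_colours[of _ _ h]) (auto simp: h_def)
      then show ?thesis using True by (simp add: d_def)
    next
      case False
      have "card K \<le> card {0, 1, 2 :: nat}"
        using K h by (intro clique_card_le_colours[of _ _ h]) (auto simp: h_def)
      then show ?thesis using False by (simp add: d_def)
    qed
  qed
  then have "symmetric_adjacency.deficit (adjacent G) (verts G) (clique_number_at G)
      \<le> deficit (verts graph_X) d"
    using deficit_iso_le[OF G finite_simple_graph_X iso] by blast
  \<comment> \<open>The value is 11 - 5 (4/3 + 1/2) = 11/6.\<close>
  also have "\<dots> < 2"
    by (simp add: deficit_def verts_graph_X nonadj_def adjacent_graph_X d_def)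
  finally show ?thesis .
qed

section \<open>Classification\<close>

text \<open>With all clique numbers equal to \<open>k\<close>, the deficit is the sum of squared
  deviations of the class sizes from their mean. Being below 2 it forces balance, and
  \<open>k\<close> times it is then the expression s (k - s) in the remainder s.\<close>

lemma (in tight_graph) balanced_classes:
  assumes "core = V"
  obtains K :: "'a set" and p :: "'a \<Rightarrow> 'a" where "finite K" "card K = k" "p ` V \<subseteq> K"
    and "\<And>u v. u \<in> V \<Longrightarrow> v \<in> V \<Longrightarrow> adj u v \<longleftrightarrow> p u \<noteq> p v"
    and "\<And>i. i \<in> K \<Longrightarrow> card {v\<in>V. p v = i} = card V div k \<or> card {v\<in>V. p v = i} = card V div k + 1"
    and "real (card V mod k) * (real k - real (card V mod k)) < 2 * real k"
proof -
  obtain K p where K: "max_clique K" and p: "p ` V \<subseteq> K"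
    and adj: "\<And>u v. u \<in> V \<Longrightarrow> v \<in> V \<Longrightarrow> adj u v \<longleftrightarrow> p u \<noteq> p v"
    using obtain_classes unfolding assms by metis
  have fin: "finite K" and card: "card K = k"
    using K max_clique_finite by (auto simp: max_clique_def)
  let ?f = "\<lambda>i. card {v\<in>V. p v = i}"
  have total: "(\<Sum>i\<in>K. ?f i) = card V"
    by (rule sum_card_classes[OF finite_V fin p])
  have "(\<Sum>u\<in>V. \<Sum>v\<in>V. nonadj u v) = (\<Sum>u\<in>V. \<Sum>v\<in>V. if p u \<noteq> p v then 0 else 1)"
    by (intro sum.cong refl) (simp add: nonadj_def adj)
  also have "\<dots> = (\<Sum>i\<in>K. (real (?f i))\<^sup>2)"
    by (rule sum_same_class[OF finite_V fin p])
  finally have nonadj: "(\<Sum>u\<in>V. \<Sum>v\<in>V. nonadj u v) = (\<Sum>i\<in>K. (real (?f i))\<^sup>2)" .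
  have "(\<Sum>v\<in>V. 1 / real (c v)) = (\<Sum>v\<in>V. 1 / real k)"
    using assms by (intro sum.cong) (auto simp: core_def)
  then have "deficit V c = (\<Sum>i\<in>K. (real (?f i))\<^sup>2) - (real (card V))\<^sup>2 / real k"
    unfolding deficit_def nonadj by (simp add: power2_eq_square)
  then have less: "(\<Sum>i\<in>K. (real (?f i))\<^sup>2) - (real (card V))\<^sup>2 / real k < 2"
    using small_deficit by simp
  then have le: "?f i \<le> ?f j + 1" if "i \<in> K" "j \<in> K" for i j
    using near_balanced[OF fin total] that card by blast
  have val: "?f i = card V div k \<or> ?f i = card V div k + 1" if "i \<in> K" for i
    using balanced_values[OF fin total le that] card by blast
  have "real k * ((\<Sum>i\<in>K. (real (?f i))\<^sup>2) - (real (card V))\<^sup>2 / real k) < real k * 2"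
    using less k_pos by (intro mult_strict_left_mono) auto
  then have "real k * (\<Sum>i\<in>K. (real (?f i))\<^sup>2) - (real (card V))\<^sup>2 < 2 * real k"
    using k_pos by (simp add: right_diff_distrib)
  then have "real (card V mod k) * (real k - real (card V mod k)) < 2 * real k"
    using balanced_sum_squares[where f = ?f, OF val card total] by simp
  then show ?thesis using fin card p adj val by (intro that[of K p]) auto
qed

text \<open>The first alternative is the graph \<open>Y\<close>, the second one is \<open>X\<close>.\<close>

lemma (in tight_graph) exceptional_graphs:
  assumes "core \<noteq> V"
  obtains z x y where "distinct [z, x, y]" "V = {z, x, y}"
      "adj x y" "\<not> adj z x" "\<not> adj z y"
  | z x y w w' where "distinct [z, x, y, w, w']" "V = {z, x, y, w, w'}"
      "\<not> adj z x" "\<not> adj z y" "\<not> adj w w'" "adj x y" "adj x w" "adj x w'" "adj y w" "adj y w'"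
      "adj z w" "adj z w'"
proof -
  obtain z where z: "z \<in> V - core" using assms by (auto simp: core_def)
  have cz: "c z + 1 = k" and V: "V = insert z core" using outside_core[OF z] .
  have finC: "finite core" using finite_V by (simp add: core_def)
  obtain K p where K: "max_clique K" and p: "p ` core \<subseteq> K" and pK: "\<And>x. x \<in> K \<Longrightarrow> p x = x"
    and adj: "\<And>u v. u \<in> core \<Longrightarrow> v \<in> core \<Longrightarrow> adj u v \<longleftrightarrow> p u \<noteq> p v"
    using obtain_classes by metis
  obtain x y where xy: "x \<in> K" "y \<in> K" "x \<noteq> y"
    and adjz: "\<And>v. v \<in> core \<Longrightarrow> adj v z \<longleftrightarrow> p v \<noteq> x \<and> p v \<noteq> y"
    using outside_core_adj[OF K p pK adj z] by metis
  have fin: "finite K" and card: "card K = k"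
    using K max_clique_finite by (auto simp: max_clique_def)
  have K_core: "K \<subseteq> core" using max_clique_core[OF K] .
  let ?f = "\<lambda>i. card {v\<in>core. p v = i}"
  have pos: "?f i \<ge> 1" if "i \<in> K" for i
  proof -
    have "i \<in> {v\<in>core. p v = i}" using that K_core pK by auto
    then have "?f i > 0" using finC by (auto simp: card_gt_0_iff)
    then show ?thesis by simp
  qed
  have total: "card core = (\<Sum>i\<in>K. ?f i)"
    using sum_card_classes[OF finC fin p] by simp
  have "(\<Sum>u\<in>core. \<Sum>v\<in>core. nonadj u v) = (\<Sum>u\<in>core. \<Sum>v\<in>core. if p u \<noteq> p v then 0 else 1)"
    by (intro sum.cong refl) (simp add: nonadj_def adj)
  also have "\<dots> = (\<Sum>i\<in>K. (real (?f i))\<^sup>2)"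
    by (rule sum_same_class[OF finC fin p])
  finally have core_sum: "(\<Sum>u\<in>core. \<Sum>v\<in>core. nonadj u v) = (\<Sum>i\<in>K. (real (?f i))\<^sup>2)" .
  have "{v\<in>core. \<not> adj v z} = {v\<in>core. p v = x} \<union> {v\<in>core. p v = y}"
    using adjz by auto
  moreover have "{v\<in>core. p v = x} \<inter> {v\<in>core. p v = y} = {}" using xy by auto
  ultimately have "card {v\<in>core. \<not> adj v z} = ?f x + ?f y"
    using finC by (simp add: card_Un_disjoint)
  then have z_sum: "(\<Sum>v\<in>core. nonadj v z) = real (?f x) + real (?f y)"
    by (simp add: sum_nonadj[OF finC])
  then have z_sum': "(\<Sum>v\<in>core. nonadj z v) = real (?f x) + real (?f y)"
    by (simp add: nonadj_sym[of z])
  have z_core: "z \<notin> core" using z by simp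
  have V_sum: "sum g V = g z + sum g core" for g :: "'a \<Rightarrow> real"
    by (rule trans[OF arg_cong[OF V, of "sum g"] sum.insert[OF finC z_core]])
  have V_card: "card V = Suc (card core)"
    by (rule trans[OF arg_cong[OF V, of card] card_insert_disjoint[OF finC z_core]])
  \<comment> \<open>The row and the column of \<open>z\<close> give the doubled term, its diagonal
    entry the final 1.\<close>
  have "(\<Sum>u\<in>V. \<Sum>v\<in>V. nonadj u v)
      = (\<Sum>i\<in>K. (real (?f i))\<^sup>2) + 2 * (real (?f x) + real (?f y)) + 1"
    unfolding V_sum by (simp add: sum.distrib core_sum z_sum z_sum')
  moreover have "(\<Sum>v\<in>V. 1 / real (c v)) = real (card core) / real k + 1 / (real k - 1)"
  proof -
    have "(\<Sum>v\<in>core. 1 / real (c v)) = (\<Sum>v\<in>core. 1 / real k)"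
      by (intro sum.cong) (auto simp: core_def)
    moreover have "real (c z) = real k - 1" using cz by simp
    ultimately show ?thesis unfolding V_sum by simp
  qed
  moreover have "real (card V) = real (card core) + 1"
    using V_card by simp
  ultimately have "(\<Sum>i\<in>K. (real (?f i))\<^sup>2) + 2 * (real (?f x) + real (?f y)) + 1
      - (real (card core) + 1) * (real (card core) / real k + 1 / (real k - 1)) < 2"
    using small_deficit unfolding deficit_def by simp
  then have res: "(k = 2 \<or> k = 3) \<and> (\<forall>i\<in>K. ?f i = (if i = x \<or> i = y then 1 else 2))"
    using exceptional_class_sizes[where f = ?f, OF fin xy pos card _ total] by blast
  have px: "p x = x" "p y = y" and xyc: "x \<in> core" "y \<in> core" using xy pK K_core by auto
  have cls: "{v\<in>core. p v = i} = {i}" if "i = x \<or> i = y" for i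
  proof -
    have "?f i = 1" using res that xy by auto
    then obtain v where v: "{v\<in>core. p v = i} = {v}" by (auto simp: card_1_singleton_iff)
    moreover have "i \<in> {v\<in>core. p v = i}" using that px xyc by auto
    ultimately have "i = v" by (simp only: singleton_iff)
    then show ?thesis using v by (simp only:)
  qed
  have cls_x: "{v\<in>core. p v = x} = {x}" and cls_y: "{v\<in>core. p v = y} = {y}"
    using cls by simp_all
  have nz: "\<not> adj z x" "\<not> adj z y" using adjz[of x] adjz[of y] px xyc adj_sym by blast+
  have xy_adj: "adj x y" using adj[OF xyc] px xy by simp
  have zne: "z \<noteq> x" "z \<noteq> y" using z_core xyc by auto
  show ?thesis
  proof (cases "k = 2")
    case True
    \<comment> \<open>For \<open>k = 2\<close> the classes of \<open>x\<close> and \<open>y\<close>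
      are the only ones, and both are singletons.\<close>
    then have "{x, y} = K" using xy fin card by (intro card_subset_eq) auto
    then have "core = {x, y}" using p cls_x cls_y px by blast
    then have "V = {z, x, y}" by (intro trans[OF V]) (simp only:)
    then show ?thesis using that(1)[of z x y] zne xy(3) xy_adj nz by simp
  next
    case False
    then have "card K = 3" using res card by simp
    \<comment> \<open>For \<open>k = 3\<close> there is one further class, of size 2: it consists of
      its representative \<open>w\<close> in \<open>K\<close> and a second vertex
      \<open>w'\<close>.\<close>
    then have "card (K - {x, y}) = 1" using xy fin by (simp add: card_Diff_subset)
    then obtain w where w: "K - {x, y} = {w}" by (auto simp: card_1_singleton_iff)
    then have wK: "w \<in> K" "w \<noteq> x" "w \<noteq> y" and K3: "K = {x, y, w}" using xy by auto
    have pw: "p w = w" and wc: "w \<in> core" using wK pK K_core by auto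
    have "?f w = 2" using res wK by simp
    then obtain a b where ab: "{v\<in>core. p v = w} = {a, b}" "a \<noteq> b" by (meson card_2_iff)
    define w' where "w' = (if a = w then b else a)"
    have "w \<in> {v\<in>core. p v = w}" using pw wc by simp
    then have "w \<in> {a, b}" unfolding ab(1) .
    then have ab': "{a, b} = {w, w'}" "w' \<noteq> w" using ab(2) by (auto simp: w'_def)
    have w': "{v\<in>core. p v = w} = {w, w'}" "w' \<noteq> w" using ab(1) ab' by simp_all
    have pw': "p w' = w" "w' \<in> core" using w' by auto
    have "core = {x, y, w, w'}"
    proof -
      have "core = {v\<in>core. p v = x} \<union> {v\<in>core. p v = y} \<union> {v\<in>core. p v = w}"
        using p K3 by blast
      then show ?thesis unfolding cls_x cls_y w'(1) by blast
    qed
    then have "V = {z, x, y, w, w'}" by (intro trans[OF V]) (simp only:)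
    moreover have "distinct [z, x, y, w, w']"
      using zne xy(3) wK w'(2) z_core wc pw' px by auto
    moreover have "\<not> adj w w'" "adj x w" "adj x w'" "adj y w" "adj y w'"
      using adj xyc wc pw' pw px wK by auto
    moreover have "adj z w" "adj z w'"
      using adjz[OF wc] adjz[OF pw'(2)] pw pw'(1) wK adj_sym by auto
    ultimately show ?thesis using that(2) nz xy_adj by blast
  qed
qed

text \<open>Symmetry and irreflexivity reduce the check to pairs in list order, which is finite and
  explicit for a listed vertex set.\<close>

lemma graph_isoI_on:
  assumes "finite_simple_graph G" and "finite_simple_graph H"
    and "verts G = set us" and "distinct us" and "verts H = f ` set us" and "inj_on f (set us)"
    and "sorted_wrt (\<lambda>u v. adjacent G u v \<longleftrightarrow> adjacent H (f u) (f v)) us"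
  shows "G \<simeq>\<^sub>G H"
proof -
  interpret G: symmetric_adjacency "adjacent G" using symmetric_adjacency_adjacent[OF assms(1)] .
  interpret H: symmetric_adjacency "adjacent H" using symmetric_adjacency_adjacent[OF assms(2)] .
  have "adjacent G u v \<longleftrightarrow> adjacent H (f u) (f v)" if uv: "u \<in> verts G" "v \<in> verts G" for u v
  proof -
    obtain i j where ij: "u = us ! i" "v = us ! j" "i < length us" "j < length us"
      using uv assms(3) by (metis in_set_conv_nth)
    consider "i < j" | "i = j" | "j < i" by linarith
    then show ?thesis
    proof cases
      case 1
      then show ?thesis using sorted_wrt_nth_less[OF assms(7)] ij by simp
    next
      case 2
      then show ?thesis using ij G.adj_irrefl H.adj_irrefl by simp
    next
      case 3
      then show ?thesis using sorted_wrt_nth_less[OF assms(7)] ij G.adj_sym H.adj_sym by metis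
    qed
  qed
  then show ?thesis
    unfolding graph_iso_def
    using assms(3,5,6) by (intro exI[of _ f]) (auto simp: bij_betw_def adjacent_def)
qed

lemma small_deficit_graphs:
  assumes G: "finite_simple_graph G" and ne: "verts G \<noteq> {}"
    and small: "symmetric_adjacency.deficit (adjacent G) (verts G) (clique_number_at G) < 2"
  shows "in_class_S G \<or> G \<simeq>\<^sub>G graph_X \<or> G \<simeq>\<^sub>G graph_Y"
proof -
  have fin: "finite (verts G)" using G by (simp add: finite_simple_graph_def)
  define k where "k = Max (clique_number_at G ` verts G)"
  interpret symmetric_adjacency "adjacent G" using symmetric_adjacency_adjacent[OF G] .
  have k: "k \<in> clique_number_at G ` verts G" unfolding k_def using fin ne by (intro Max_in) auto
  interpret tight_graph "adjacent G" "verts G" "clique_number_at G" k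
  proof unfold_locales
    show "clique_number_at G v \<le> k" if "v \<in> verts G" for v
      unfolding k_def using fin that by simp
    show "\<exists>v\<in>verts G. clique_number_at G v = k" using k by auto
  qed (use fin small clique_number_at_clique_bound[OF G] in auto)
  show ?thesis
  proof (cases "core = verts G")
    case True
    have "card (verts G) > 0" "k > 0" using fin ne k_pos by (auto simp: card_gt_0_iff)
    moreover have "in_class_S G" if "finite K" "card K = k" "p ` verts G \<subseteq> K"
      and "\<And>u v. u \<in> verts G \<Longrightarrow> v \<in> verts G \<Longrightarrow> adjacent G u v \<longleftrightarrow> p u \<noteq> p v"
      and "\<And>i. i \<in> K \<Longrightarrow> card {v\<in>verts G. p v = i} = card (verts G) div k \<or>
        card {v\<in>verts G. p v = i} = card (verts G) div k + 1"
      and "real (card (verts G) mod k) * (real k - real (card (verts G) mod k)) < 2 * real k"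
      for K :: "'a set" and p
      using balanced_classes_in_class_S[where p = p, OF fin refl _ that(1,2) _ that(3,5)
        that(4)[unfolded adjacent_def] that(6)] calculation by simp
    ultimately show ?thesis using balanced_classes[OF True] by blast
  next
    case False
    from exceptional_graphs[OF this] show ?thesis
    proof cases
      case (1 z x y)
      have "G \<simeq>\<^sub>G graph_Y"
        using G finite_simple_graph_Y
      proof (rule graph_isoI_on)
        \<comment> \<open>\<open>z\<close> goes to the isolated vertex, the edge from
          \<open>x\<close> to \<open>y\<close> to the edge from 0 to 2.\<close>
        let ?us = "[z, x, y]" and ?f = "\<lambda>v. if v = z then 1 else if v = x then 0 else 2 :: nat"
        show "verts G = set ?us" "distinct ?us" using 1 by auto
        show "verts graph_Y = ?f ` set ?us" using 1(1) by (auto simp: verts_graph_Y)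
        show "inj_on ?f (set ?us)" using 1(1) by (auto simp: inj_on_def)
        show "sorted_wrt (\<lambda>u v. adjacent G u v \<longleftrightarrow> adjacent graph_Y (?f u) (?f v)) ?us"
          using 1 by (auto simp: adjacent_graph_Y)
      qed
      then show ?thesis by simp
    next
      case (2 z x y w w')
      have "G \<simeq>\<^sub>G graph_X"
        using G finite_simple_graph_X
      proof (rule graph_isoI_on)
        \<comment> \<open>In the complement \<open>x\<close>, \<open>z\<close>, \<open>y\<close>
          form the three-vertex path with \<open>z\<close> in the middle, and \<open>w\<close>,
          \<open>w'\<close> form the separate edge.\<close>
        let ?us = "[z, x, y, w, w']"
          and ?f = "\<lambda>v. if v = z then Inr 1 else if v = x then Inr 0 else if v = y then Inr 2
            else if v = w then Inl 0 else Inl 1 :: nat + nat"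
        show "verts G = set ?us" "distinct ?us" using 2 by auto
        show "verts graph_X = ?f ` set ?us" using 2(1) by (auto simp: verts_graph_X)
        show "inj_on ?f (set ?us)" using 2(1) by (auto simp: inj_on_def)
        show "sorted_wrt (\<lambda>u v. adjacent G u v \<longleftrightarrow> adjacent graph_X (?f u) (?f v)) ?us"
          using 2 by (auto simp: adjacent_graph_X verts_graph_X)
      qed
      then show ?thesis by simp
    qed
  qed
qed

theorem theorem5:
  fixes G :: "'a sgraph" and n :: nat
  assumes "finite_simple_graph G"
    and "n = card (verts G)"
    and "n \<ge> 1"
  shows "int (card (edges G)) \<le>
           \<lfloor>real n / 2 * (\<Sum>v\<in>verts G.
              (real (clique_number_at G v) - 1) / real (clique_number_at G v))\<rfloor> \<and>
         (int (card (edges G)) =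
           \<lfloor>real n / 2 * (\<Sum>v\<in>verts G.
              (real (clique_number_at G v) - 1) / real (clique_number_at G v))\<rfloor> \<longleftrightarrow>
           in_class_S G \<or> G \<simeq>\<^sub>G graph_X \<or> G \<simeq>\<^sub>G graph_Y)"
proof -
  interpret symmetric_adjacency "adjacent G" using symmetric_adjacency_adjacent[OF assms(1)] .
  let ?D = "deficit (verts G) (clique_number_at G)"
  have fin: "finite (verts G)" and ne: "verts G \<noteq> {}"
    using assms by (auto simp: finite_simple_graph_def)
  note bound = clique_number_at_clique_bound(1)[OF assms(1)]
  have nonneg: "?D \<ge> 0" using deficit_nonneg[OF fin bound] .
  have eq: "real n / 2 * (\<Sum>v\<in>verts G.
      (real (clique_number_at G v) - 1) / real (clique_number_at G v)) = real (card (edges G)) + ?D / 2"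
    using edge_bound_minus_edges[OF assms(1) clique_bound_pos[OF bound]] assms(2) by simp
  have "int (card (edges G)) \<le> \<lfloor>real (card (edges G)) + ?D / 2\<rfloor>"
    using nonneg by (simp add: le_floor_iff)
  \<comment> \<open>The floor exceeds the integer part \<open>card (edges G)\<close> exactly when
    half the deficit reaches 1.\<close>
  moreover have "int (card (edges G)) = \<lfloor>real (card (edges G)) + ?D / 2\<rfloor> \<longleftrightarrow> ?D < 2"
    using nonneg by (auto simp: floor_eq_iff eq_commute[of "int (card (edges G))"])
  moreover have "?D < 2 \<longleftrightarrow> in_class_S G \<or> G \<simeq>\<^sub>G graph_X \<or> G \<simeq>\<^sub>G graph_Y"
    using small_deficit_graphs[OF assms(1) ne] in_class_S_deficit[OF assms(1)]
      graph_X_deficit[OF assms(1)] graph_Y_deficit[OF assms(1)] by blast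
  ultimately show ?thesis unfolding eq by simp
qed

end
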